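(* Fix $n\geq3$ and run the $n$-GHZ state generation protocol (see context), and suppose it heralds success with some measurement pattern $\vec m$. Assume all input photons except those in input modes $2i,2i+1$ (for a fixed $0\le i<n$) are ideal, with internal state $\eta_0=|\psi_0\rangle\langle\psi_0|$, and let $\eta_1=|\psi_1\rangle\langle\psi_1|$ with $\mathrm{Tr}(\eta_0\eta_1)=0$. (1) If the input photons in modes $2i,2i+1$ are in the state $\frac12\big(a^\dagger_{2i}(\eta_0)a^\dagger_{2i+1}(\eta_1)|\vec0\rangle\langle\vec0|a_{2i+1}(\eta_1)a_{2i}(\eta_0)+a^\dagger_{2i}(\eta_1)a^\dagger_{2i+1}(\eta_0)|\vec0\rangle\langle\vec0|a_{2i+1}(\eta_0)a_{2i}(\eta_1)\big)$, then after dual-rail projection the output state is $\frac12P_{X_i}\big(P_{Z_i}(|B_+\rangle\langle B_+|)+D_i(|B_+\rangle\langle B_+|)\big)$. (2) If instead both input photons in modes $2i,2i+1$ have the same internal state $\eta_1$, then the output state is $P_{Z_i}(D_i(|B_+\rangle\langle B_+|))$, with no dual-rail projection required.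
   Context: Photonic model: $a_j^\dagger(\eta)$ creates a photon in spatial mode $j$ with internal state $\eta$ (pure); linear optics acts on spatial modes only; photon-number-resolving (PNR) detection reveals only photon number per spatial mode, with post-measurement states obtained by projecting and tracing out internal states of measured photons. Hadamard beamsplitter $H$ on ordered pair $(p,q)$: $a_p^\dagger\mapsto(a_p^\dagger+a_q^\dagger)/\sqrt2$, $a_q^\dagger\mapsto(a_p^\dagger-a_q^\dagger)/\sqrt2$. The $n$-GHZ state analyzer on $2n$ modes labeled $0,\dots,2n-1$: apply $H$ to each ordered pair in $\{(1,2),(3,4),\dots,(2n-3,2n-2),(2n-1,0)\}$, PNR-measure all modes getting $(m_0,\dots,m_{2n-1})$, succeed iff $m_{2k+1}+m_{2k+2}=1$ for all $0\le k<n$ ($m_{2n}=m_0$); it reports $(-1)^{s_{\mathrm{odd}}}$ as the value of $X\cdots X$, where $s_{\mathrm{odd}}$ is the number of photons detected in its odd-indexed modes. The $n$-GHZ generation protocol on modes $0,\dots,4n-1$: (1) input one photon in each of modes $0,\dots,2n-1$, vacuum elsewhere; (2) apply $H$ on each $(2k,2k+1)$, $0\le k<n$; (3) apply $H$ on each $(k,2n+k)$, $0\le k<2n$; (4) apply the $n$-GHZ analyzer to modes $2n,\dots,4n-1$ (mode $2n+j$ as analyzer mode $j$), proceeding iff success; (5) if the analyzer reports $-1$, apply a phase $-1$ to mode $1$. Output: modes $0,\dots,2n-1$, viewed as $n$ dual-rail qubits on pairs $(2k,2k+1)$ with $|\mathbf0\rangle=|1,0\rangle,|\mathbf1\rangle=|0,1\rangle$;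 $X_k$ swaps the modes of qubit $k$, $Z_k$ applies phase $-1$ to mode $2k+1$. $|B_+\rangle=\frac1{\sqrt2}(|1,0\rangle^{\otimes n}+|0,1\rangle^{\otimes n})$ with all photons in internal state $\psi_0$. For an operator $A$, $P_A(\gamma)=\frac12(\gamma+A\gamma A^\dagger)$. $D_k$ is the operator on modes $2k,2k+1$ with $a_{2k}^\dagger(\psi_0)|\vec0\rangle\mapsto a_{2k}^\dagger(\psi_1)|\vec0\rangle$ and $a_{2k+1}^\dagger(\psi_0)|\vec0\rangle\mapsto a_{2k+1}^\dagger(\psi_1)|\vec0\rangle$ (changing the internal state of the photon of qubit $k$ to $\psi_1$), and $D_k(\rho)=D_k\rho D_k^\dagger$. Dual-rail projection: projecting (and renormalizing) onto the span of states with exactly one photon in each pair $(2k,2k+1)$. *)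

theory Defs
  imports "HOL-Analysis.Analysis" "HOL-Library.Multiset" "HOL-Library.Poly_Mapping"
begin

(* ------------------------------------------------------------------------
   Photonic model.
   A single-photon label is (spatial mode, internal state); the internal state
   is False for psi_0 and True for psi_1 (psi_0, psi_1 orthonormal; only their
   span is ever populated).  A Fock basis state is a multiset of labels.
   ------------------------------------------------------------------------ *)

type_synonym label = "nat \<times> bool"
type_synonym fock = "label multiset"

(* Polynomials in the (commuting) creation operators a^dagger_l; the monomial M
   stands for  prod_{l in# M} a^dagger_l |vac>  (NOT normalised). *)
type_synonym cpoly = "fock \<Rightarrow>\<^sub>0 complex"

(* Density operators, given by matrix elements <R|rho|R'> in the normalised
   occupation-number basis |R>. *)
type_synonym dens = "fock \<Rightarrow> fock \<Rightarrow> complex"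

definition mc :: "fock \<Rightarrow> nat \<Rightarrow> nat" where
  "mc R q = size (filter_mset (\<lambda>l. fst l = q) R)"

(* amplitude of the state  P(a^dagger)|vac>  on the normalised basis vector |M> *)
definition vec :: "cpoly \<Rightarrow> fock \<Rightarrow> complex" where
  "vec P M = Poly_Mapping.lookup P M * complex_of_real (sqrt (real (\<Prod>l\<in>set_mset M. fact (count M l))))"

definition ens_dens :: "(real \<times> cpoly) list \<Rightarrow> dens" where
  "ens_dens E R R' = sum_list (map (\<lambda>(p, P). complex_of_real p * vec P R * cnj (vec P R')) E)"

(* U r c = coefficient of a^dagger_r in the image of a^dagger_c *)
definition lin_form :: "(nat \<Rightarrow> nat \<Rightarrow> complex) \<Rightarrow> label \<Rightarrow> cpoly" where
  "lin_form U l = (\<Sum>r\<in>{r. U r (fst l) \<noteq> 0}. Poly_Mapping.single {#(r, snd l)#} (U r (fst l)))"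

definition lin_optics :: "(nat \<Rightarrow> nat \<Rightarrow> complex) \<Rightarrow> cpoly \<Rightarrow> cpoly" where
  "lin_optics U P = (\<Sum>M\<in>Poly_Mapping.keys P.
      Poly_Mapping.single {#} (Poly_Mapping.lookup P M) * prod_mset (image_mset (lin_form U) M))"

definition hmat :: "nat \<Rightarrow> nat \<Rightarrow> nat \<Rightarrow> nat \<Rightarrow> complex" where
  "hmat p q r c =
     (if c = p then (if r = p \<or> r = q then 1 / complex_of_real (sqrt 2) else 0)
      else if c = q then (if r = p then 1 / complex_of_real (sqrt 2)
                          else if r = q then - 1 / complex_of_real (sqrt 2) else 0)
      else (if r = c then 1 else 0))"

definition apply_H_list :: "(nat \<times> nat) list \<Rightarrow> cpoly \<Rightarrow> cpoly" where
  "apply_H_list ps P = fold (\<lambda>(p, q) Q. lin_optics (hmat p q) Q) ps P"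

definition step2_pairs :: "nat \<Rightarrow> (nat \<times> nat) list" where
  "step2_pairs n = map (\<lambda>k. (2*k, 2*k+1)) [0..<n]"

definition step3_pairs :: "nat \<Rightarrow> (nat \<times> nat) list" where
  "step3_pairs n = map (\<lambda>k. (k, 2*n+k)) [0..<2*n]"

(* analyzer pairs (1,2),(3,4),...,(2n-3,2n-2),(2n-1,0), analyzer mode j = mode 2n+j *)
definition analyzer_pairs :: "nat \<Rightarrow> (nat \<times> nat) list" where
  "analyzer_pairs n = map (\<lambda>k. (2*n + (2*k+1), 2*n + ((2*k+2) mod (2*n)))) [0..<n]"

definition protocol_optics :: "nat \<Rightarrow> cpoly \<Rightarrow> cpoly" where
  "protocol_optics n P = apply_H_list (step2_pairs n @ step3_pairs n @ analyzer_pairs n) P"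

(* analyzer success for the outcome m (m j = photons detected in analyzer mode j) *)
definition analyzer_success :: "nat \<Rightarrow> (nat \<Rightarrow> nat) \<Rightarrow> bool" where
  "analyzer_success n m = (\<forall>k<n. m (2*k+1) + m ((2*k+2) mod (2*n)) = 1)"

definition s_odd :: "nat \<Rightarrow> (nat \<Rightarrow> nat) \<Rightarrow> nat" where
  "s_odd n m = (\<Sum>k<n. m (2*k+1))"

definition meas_set :: "nat \<Rightarrow> (nat \<Rightarrow> nat) \<Rightarrow> fock set" where
  "meas_set n m = {A. (\<forall>l\<in>#A. 2*n \<le> fst l \<and> fst l < 4*n) \<and> (\<forall>j<2*n. mc A (2*n+j) = m j)}"

(* PNR projection onto outcome m on modes 2n..4n-1, followed by tracing out the
   measured photons (including their internal states); result lives on the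
   output modes 0..2n-1 (unnormalised) *)
definition post_meas :: "nat \<Rightarrow> (nat \<Rightarrow> nat) \<Rightarrow> dens \<Rightarrow> dens" where
  "post_meas n m \<rho> R R' =
     (if (\<forall>l\<in>#R. fst l < 2*n) \<and> (\<forall>l\<in>#R'. fst l < 2*n)
      then (\<Sum>A\<in>meas_set n m. \<rho> (A + R) (A + R')) else 0)"

definition dtrace :: "dens \<Rightarrow> complex" where
  "dtrace \<rho> = infsum (\<lambda>R. \<rho> R R) UNIV"

definition dnormalize :: "dens \<Rightarrow> dens" where
  "dnormalize \<rho> R R' = \<rho> R R' / dtrace \<rho>"

(* phase -1 on mode q (conjugation rho -> Z rho Z) *)
definition phase_mode :: "nat \<Rightarrow> dens \<Rightarrow> dens" where
  "phase_mode q \<rho> R R' = (-1) ^ (mc R q + mc R' q) * \<rho> R R'"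

definition unnorm_out :: "nat \<Rightarrow> (nat \<Rightarrow> nat) \<Rightarrow> (real \<times> cpoly) list \<Rightarrow> dens" where
  "unnorm_out n m E =
     post_meas n m (ens_dens (map (\<lambda>(p, P). (p, protocol_optics n P)) E))"

definition heralds :: "nat \<Rightarrow> (nat \<Rightarrow> nat) \<Rightarrow> (real \<times> cpoly) list \<Rightarrow> bool" where
  "heralds n m E = (analyzer_success n m \<and> dtrace (unnorm_out n m E) \<noteq> 0)"

(* normalised output state, including the correction of step (5) *)
definition ghz_out :: "nat \<Rightarrow> (nat \<Rightarrow> nat) \<Rightarrow> (real \<times> cpoly) list \<Rightarrow> dens" where
  "ghz_out n m E =
     dnormalize (if odd (s_odd n m) then phase_mode 1 (unnorm_out n m E) else unnorm_out n m E)"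

definition input_poly :: "nat \<Rightarrow> (nat \<Rightarrow> bool) \<Rightarrow> cpoly" where
  "input_poly n s = Poly_Mapping.single (mset (map (\<lambda>j. (j, s j)) [0..<2*n])) 1"

definition dual_rail :: "nat \<Rightarrow> fock \<Rightarrow> bool" where
  "dual_rail n R = (\<forall>k<n. mc R (2*k) + mc R (2*k+1) = 1)"

definition dr_proj :: "nat \<Rightarrow> dens \<Rightarrow> dens" where
  "dr_proj n \<rho> = dnormalize (\<lambda>R R'. if dual_rail n R \<and> dual_rail n R' then \<rho> R R' else 0)"

definition Bplus_vec :: "nat \<Rightarrow> fock \<Rightarrow> complex" where
  "Bplus_vec n R =
     (if R = mset (map (\<lambda>k. (2*k, False)) [0..<n]) \<or> R = mset (map (\<lambda>k. (2*k+1, False)) [0..<n])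
      then 1 / complex_of_real (sqrt 2) else 0)"

definition Bplus :: "nat \<Rightarrow> dens" where
  "Bplus n R R' = Bplus_vec n R * cnj (Bplus_vec n R')"

definition swap_lab :: "nat \<Rightarrow> label \<Rightarrow> label" where
  "swap_lab k l = (if fst l = 2*k then (2*k+1, snd l) else if fst l = 2*k+1 then (2*k, snd l) else l)"

definition conjX :: "nat \<Rightarrow> dens \<Rightarrow> dens" where
  "conjX k \<rho> R R' = \<rho> (image_mset (swap_lab k) R) (image_mset (swap_lab k) R')"

definition conjZ :: "nat \<Rightarrow> dens \<Rightarrow> dens" where
  "conjZ k \<rho> = phase_mode (2*k+1) \<rho>"

definition twirl :: "(dens \<Rightarrow> dens) \<Rightarrow> dens \<Rightarrow> dens" where
  "twirl conjA \<gamma> R R' = (\<gamma> R R' + conjA \<gamma> R R') / 2"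

(* D_k: change the internal state of the photon(s) in modes 2k,2k+1 from psi_0
   to psi_1 (relabelling |M> -> |f M>); conjugation rho -> D rho D^dag *)
definition D_lab :: "nat \<Rightarrow> label \<Rightarrow> label" where
  "D_lab k l = (if fst l = 2*k \<or> fst l = 2*k+1 then (fst l, True) else l)"

definition conjD :: "nat \<Rightarrow> dens \<Rightarrow> dens" where
  "conjD k \<rho> N N' =
     (\<Sum>M\<in>{M. image_mset (D_lab k) M = N}. \<Sum>M'\<in>{M'. image_mset (D_lab k) M' = N'}. \<rho> M M')"

definition dmix :: "dens \<Rightarrow> dens \<Rightarrow> dens" where
  "dmix \<gamma> \<delta> R R' = (\<gamma> R R' + \<delta> R R') / 2"

end

theory Submission
  imports Defs
begin

text \<open>
  Linear optics acts on products of creation operators by substituting linear forms, so the final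
  state is a product of \<open>n\<close> quadratic factors, one for each pair of input modes \<open>2k, 2k+1\<close>.
  Such a factor has the shape \<open>(E + O)(E' - O')\<close>, where \<open>E\<close> and \<open>O\<close> involve only the even
  and the odd mode of the pair together with the analyzer modes fed by them; if both photons have
  equal internal states, the cross terms cancel (Hong-Ou-Mandel). A successful pattern shows exactly
  one click in each analyzer pair. If each factor contributes exactly one click, which either the
  dual-rail projection or the cancellation in all factors enforces, then going around the cycle of
  analyzer pairs forces all detected photons to the same side \<open>\<sigma>\<close>. Only the side \<open>\<tau>\<close>
  and the label \<open>t\<close> of the output photon of qubit \<open>i\<close> and the label \<open>u\<close> of its detected
  photon remain free. The two sides stay coherent unless the analyzer registers a photon in
  \<open>\<psi>\<^sub>1\<close>, which reveals \<open>\<sigma>\<close> by its position; comparing the remaining amplitudes on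
  these output states gives both formulas.
\<close>

subsection \<open>Linear optics as substitution\<close>

lemma poly_mapping_sum_singles:
  fixes P :: "'a \<Rightarrow>\<^sub>0 'b::comm_monoid_add"
  shows "(\<Sum>M\<in>Poly_Mapping.keys P. Poly_Mapping.single M (Poly_Mapping.lookup P M)) = P"
  by (rule poly_mapping_eqI)
     (auto simp: lookup_sum lookup_single when_def in_keys_iff sum.delta)

text \<open>Terms outside the support vanish, so two polynomials and their sum can be expanded over
  one common index set.\<close>

lemma lin_optics_superset:
  assumes "finite S" "Poly_Mapping.keys P \<subseteq> S"
  shows "lin_optics U P = (\<Sum>M\<in>S. Poly_Mapping.single {#} (Poly_Mapping.lookup P M) *
           prod_mset (image_mset (lin_form U) M))"
  unfolding lin_optics_def using assms
  by (intro sum.mono_neutral_left) (auto simp: in_keys_iff)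

lemma lin_optics_add: "lin_optics U (P + Q) = lin_optics U P + lin_optics U Q"
proof -
  let ?S = "Poly_Mapping.keys P \<union> Poly_Mapping.keys Q"
  have *: "finite ?S" "Poly_Mapping.keys P \<subseteq> ?S" "Poly_Mapping.keys Q \<subseteq> ?S" 
    "Poly_Mapping.keys (P + Q) \<subseteq> ?S"
    using keys_add[of P Q] by auto
  show ?thesis
    unfolding lin_optics_superset[OF *(1,2)] lin_optics_superset[OF *(1,3)]
      lin_optics_superset[OF *(1,4)]
    by (simp add: lookup_add single_add distrib_right sum.distrib)
qed

lemma lin_optics_0: "lin_optics U 0 = 0"
  by (simp add: lin_optics_def)

lemma lin_optics_sum: "lin_optics U (\<Sum>x\<in>X. f x) = (\<Sum>x\<in>X. lin_optics U (f x))"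
  by (induction X rule: infinite_finite_induct) (auto simp: lin_optics_0 lin_optics_add)

lemma lin_optics_single:
  "lin_optics U (Poly_Mapping.single M c) =
     Poly_Mapping.single {#} c * prod_mset (image_mset (lin_form U) M)"
  by (subst lin_optics_superset[of "{M}"]) auto

text \<open>On monomials the labels of a product are the multiset union; additivity extends this to
  all polynomials. Linear optics is thus a ring homomorphism, and products of creation operators
  transform factor by factor.\<close>

lemma lin_optics_mult: "lin_optics U (P * Q) = lin_optics U P * lin_optics U Q"
proof -
  have s: "lin_optics U (Poly_Mapping.single M c * Poly_Mapping.single N d) =
    lin_optics U (Poly_Mapping.single M c) * lin_optics U (Poly_Mapping.single N d)" for M N c d
  proof -
    have c: "Poly_Mapping.single {#} (c * d) = Poly_Mapping.single ({#} :: fock) c * Poly_Mapping.single {#} d"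
      by (simp add: mult_single)
    show ?thesis
      unfolding mult_single lin_optics_single image_mset_union prod_mset_Un
      by (simp only: add_0_left c mult_ac)
  qed
  have "lin_optics U (P * Q) = lin_optics U
      ((\<Sum>M\<in>Poly_Mapping.keys P. Poly_Mapping.single M (Poly_Mapping.lookup P M)) *
       (\<Sum>M\<in>Poly_Mapping.keys Q. Poly_Mapping.single M (Poly_Mapping.lookup Q M)))"
    by (simp only: poly_mapping_sum_singles)
  also have "\<dots> = lin_optics U
      (\<Sum>M\<in>Poly_Mapping.keys P. Poly_Mapping.single M (Poly_Mapping.lookup P M)) *
      lin_optics U (\<Sum>M\<in>Poly_Mapping.keys Q. Poly_Mapping.single M (Poly_Mapping.lookup Q M))"
    unfolding sum_product lin_optics_sum s ..
  finally show ?thesis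
    by (simp only: poly_mapping_sum_singles)
qed

lemma lin_optics_1: "lin_optics U 1 = 1"
  by (simp add: lin_optics_single mult_single flip: single_one)

lemma lin_optics_prod: "lin_optics U (\<Prod>x\<in>X. f x) = (\<Prod>x\<in>X. lin_optics U (f x))"
  by (induction X rule: infinite_finite_induct) (auto simp: lin_optics_1 lin_optics_mult)

section \<open>Linear forms and their coefficient vectors\<close>

definition lform :: "bool \<Rightarrow> (nat \<Rightarrow> complex) \<Rightarrow> cpoly" where
  "lform t v = (\<Sum>r\<in>{r. v r \<noteq> 0}. Poly_Mapping.single {#(r, t)#} (v r))"

lemma lin_form_eq_lform: "lin_form U l = lform (snd l) (\<lambda>r. U r (fst l))"
  by (simp add: lin_form_def lform_def)

lemma lform_superset:
  assumes "finite S" "\<And>r. v r \<noteq> 0 \<Longrightarrow> r \<in> S"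
  shows "lform t v = (\<Sum>r\<in>S. Poly_Mapping.single {#(r, t)#} (v r))"
  unfolding lform_def using assms by (intro sum.mono_neutral_left) auto

definition hact :: "nat \<times> nat \<Rightarrow> (nat \<Rightarrow> complex) \<Rightarrow> nat \<Rightarrow> complex" where
  "hact pq v r = (if r = fst pq then (v (fst pq) + v (snd pq)) / complex_of_real (sqrt 2)
     else if r = snd pq then (v (fst pq) - v (snd pq)) / complex_of_real (sqrt 2) else v r)"

lemma finite_support_hact:
  assumes "finite {r. v r \<noteq> 0}"
  shows "finite {r. hact pq v r \<noteq> 0}"
  by (rule finite_subset[of _ "insert (fst pq) (insert (snd pq) {r. v r \<noteq> 0})"])
     (use assms in \<open>auto simp: hact_def split: if_splits\<close>)

lemma lin_optics_hmat_lform: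
  assumes fin: "finite {r. v r \<noteq> 0}" and "p \<noteq> q"
  shows "lin_optics (hmat p q) (lform t v) = lform t (hact (p, q) v)"
proof -
  let ?R = "{r. v r \<noteq> 0} - {p, q}" and ?S = "insert p (insert q ({r. v r \<noteq> 0} - {p, q}))"
  let ?h = "1 / complex_of_real (sqrt 2)" and ?sg = "\<lambda>r c. Poly_Mapping.single {#(r, t)#} c"
  have split: "(\<Sum>r\<in>?S. f r) = f p + f q + (\<Sum>r\<in>?R. f r)" for f :: "nat \<Rightarrow> cpoly"
    using fin \<open>p \<noteq> q\<close> by (simp add: add.assoc)
  have m0: "Poly_Mapping.single {#} c * Poly_Mapping.single M d = Poly_Mapping.single M (c * d)"
    for c d :: complex and M :: fock
    by (simp add: mult_single)
  have lp: "lin_form (hmat p q) (p, t) = ?sg p ?h + ?sg q ?h"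
    unfolding lin_form_eq_lform
    by (subst lform_superset[of "{p, q}"]) (use \<open>p \<noteq> q\<close> in \<open>auto simp: hmat_def split: if_splits\<close>)
  have lq: "lin_form (hmat p q) (q, t) = ?sg p ?h + ?sg q (- ?h)"
    unfolding lin_form_eq_lform
    by (subst lform_superset[of "{p, q}"]) (use \<open>p \<noteq> q\<close> in \<open>auto simp: hmat_def split: if_splits\<close>)
  have lr: "lin_form (hmat p q) (r, t) = ?sg r 1" if "r \<in> ?R" for r
    unfolding lin_form_eq_lform
    by (subst lform_superset[of "{r}"]) (use that in \<open>auto simp: hmat_def split: if_splits\<close>)
  have "lin_optics (hmat p q) (lform t v) =
      (\<Sum>r\<in>?S. Poly_Mapping.single {#} (v r) * lin_form (hmat p q) (r, t))"
    by (subst lform_superset[of ?S])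
       (use fin in \<open>auto simp: lin_optics_sum lin_optics_single simp del: sum.insert_remove\<close>)
  also have "\<dots> = (?sg p (v p * ?h) + ?sg q (v p * ?h)) + (?sg p (v q * ?h) + ?sg q (v q * - ?h))
      + (\<Sum>r\<in>?R. ?sg r (v r))"
    unfolding split lp lq distrib_left m0
    by (intro arg_cong2[where f = "(+)"] refl sum.cong) (simp only: lr m0 mult_1_right)
  also have "\<dots> = ?sg p (hact (p, q) v p) + ?sg q (hact (p, q) v q)
      + (\<Sum>r\<in>?R. ?sg r (hact (p, q) v r))"
    using \<open>p \<noteq> q\<close> by (simp add: hact_def add_divide_distrib diff_divide_distrib single_add single_diff
      single_uminus)
  also have "\<dots> = lform t (hact (p, q) v)"
    using lform_superset[of ?S "hact (p, q) v" t] fin unfolding split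
    by (auto simp: hact_def split: if_splits)
  finally show ?thesis .
qed

text \<open>Each beamsplitter acts on every linear form separately, so a many-photon state is
  described by one coefficient vector per photon. Finite support is carried along because
  \<open>lform\<close> sums over the support, and a sum over an infinite set is 0.\<close>

lemma apply_H_list_prod_lform:
  assumes "\<And>pq. pq \<in> set ps \<Longrightarrow> fst pq \<noteq> snd pq"
    and "\<And>j. j \<in> J \<Longrightarrow> finite {r. v j r \<noteq> 0}"
  shows "apply_H_list ps (\<Prod>j\<in>J. lform (t j) (v j)) = (\<Prod>j\<in>J. lform (t j) (fold hact ps (v j)))"
  using assms
proof (induction ps arbitrary: v)
  case Nil
  then show ?case by (simp add: apply_H_list_def)
next
  case (Cons pq ps)
  obtain p q where pq: "pq = (p, q)" by (cases pq)
  have "p \<noteq> q" using Cons.prems(1)[of pq] pq by simp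
  have "apply_H_list (pq # ps) (\<Prod>j\<in>J. lform (t j) (v j)) =
     apply_H_list ps (\<Prod>j\<in>J. lform (t j) (hact pq (v j)))"
    using lin_optics_hmat_lform[OF Cons.prems(2) \<open>p \<noteq> q\<close>]
    by (simp add: apply_H_list_def pq lin_optics_prod)
  also have "\<dots> = (\<Prod>j\<in>J. lform (t j) (fold hact ps (hact pq (v j))))"
    using Cons.prems by (intro Cons.IH) (auto simp: finite_support_hact)
  finally show ?case by simp
qed

section \<open>Layers of beamsplitters on disjoint pairs\<close>

abbreviation pair_modes :: "(nat \<times> nat) list \<Rightarrow> nat list" where
  "pair_modes ps \<equiv> concat (map (\<lambda>pq. [fst pq, snd pq]) ps)"

lemma fold_hact_idle: "r \<notin> set (pair_modes ps) \<Longrightarrow> fold hact ps v r = v r"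
  by (induction ps arbitrary: v) (auto simp: hact_def)

text \<open>In a layer of disjoint pairs only one gate touches \<open>p\<close> and
  \<open>q\<close>: the earlier gates leave its inputs alone, the later ones its outputs.\<close>

lemma fold_hact_pair:
  assumes "distinct (pair_modes ps)" "(p, q) \<in> set ps"
  shows "fold hact ps v p = (v p + v q) / complex_of_real (sqrt 2)"
    and "fold hact ps v q = (v p - v q) / complex_of_real (sqrt 2)"
proof -
  have "fold hact ps v p = (v p + v q) / complex_of_real (sqrt 2) \<and>
        fold hact ps v q = (v p - v q) / complex_of_real (sqrt 2)"
    using assms
  proof (induction ps arbitrary: v)
    case (Cons pq ps)
    show ?case
    proof (cases "pq = (p, q)")
      case True
      then have "p \<notin> set (pair_modes ps)" "q \<notin> set (pair_modes ps)" "p \<noteq> q"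
        using Cons.prems by auto
      then show ?thesis by (simp add: True fold_hact_idle) (simp add: hact_def)
    next
      case False
      then have "(p, q) \<in> set ps" using Cons.prems by simp
      moreover from this have "p \<in> set (pair_modes ps)" "q \<in> set (pair_modes ps)" by force+
      then have "hact pq v p = v p" "hact pq v q = v q" 
        using Cons.prems by (auto simp: hact_def)
      ultimately show ?thesis using Cons by simp
    qed
  qed simp
  then show "fold hact ps v p = (v p + v q) / complex_of_real (sqrt 2)"
    "fold hact ps v q = (v p - v q) / complex_of_real (sqrt 2)" by simp_all
qed

lemma distinct_pair_modes_map:
  assumes "\<And>k. k < N \<Longrightarrow> f k \<noteq> g k"
    and "\<And>k l. k < N \<Longrightarrow> l < N \<Longrightarrow> k \<noteq> l \<Longrightarrow> f k \<noteq> f l \<and> f k \<noteq> g l \<and> g k \<noteq> g l"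
  shows "distinct (pair_modes (map (\<lambda>k. (f k, g k)) [0..<N]))"
  using assms
proof (induction N)
  case (Suc N)
  have a: "f N \<noteq> f k \<and> f N \<noteq> g k \<and> g N \<noteq> f k \<and> g N \<noteq> g k" if "k < N" for k
    using Suc.prems(2)[of N k] Suc.prems(2)[of k N] that by auto
  have b: "distinct (pair_modes (map (\<lambda>k. (f k, g k)) [0..<N]))"
    using Suc.prems by (intro Suc.IH) auto
  show ?case using a b Suc.prems(1)[of N] by (auto; metis)
qed simp

subsection \<open>Single-photon amplitudes\<close>

text \<open>Amplitude with which the photon entering mode \<open>j\<close> leaves the whole circuit,
  as a function of the exit mode; internal states do not enter.\<close>

definition amp :: "nat \<Rightarrow> nat \<Rightarrow> nat \<Rightarrow> complex" where
  "amp n j = fold hact (step2_pairs n @ step3_pairs n @ analyzer_pairs n) (\<lambda>r. if r = j then 1 else 0)"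

lemma finite_support_fold_hact:
  "finite {r. v r \<noteq> 0} \<Longrightarrow> finite {r. fold hact ps v r \<noteq> 0}"
  by (induction ps arbitrary: v) (auto simp: finite_support_hact)

lemma finite_support_amp: "finite {r. amp n j r \<noteq> 0}"
  unfolding amp_def by (rule finite_support_fold_hact) simp

lemma input_poly_prod: "input_poly n s = (\<Prod>j<2*n. lform (s j) (\<lambda>r. if r = j then 1 else 0))"
proof -
  have "Poly_Mapping.single (mset (map (\<lambda>j. (j, s j)) [0..<N])) 1 =
      (\<Prod>j<N. lform (s j) (\<lambda>r. if r = j then 1 else 0))" for N
  proof (induction N)
    case (Suc N)
    have "lform (s N) (\<lambda>r. if r = N then 1 else 0) = Poly_Mapping.single {#(N, s N)#} 1"
      by (subst lform_superset[of "{N}"]) (auto split: if_splits)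
    then show ?case using Suc.IH[symmetric] by (simp add: mult_single)
  qed simp
  then show ?thesis by (simp add: input_poly_def)
qed

lemma analyzer_pairs_eq: "analyzer_pairs n =
    map (\<lambda>k. (2*n + (2*k+1), 2*n + 2 * (Suc k mod n))) [0..<n]"
proof -
  have "(2*k+2) mod (2*n) = 2 * (Suc k mod n)" for k
    using mult_mod_right[of 2 "Suc k" n] by simp
  then show ?thesis by (simp add: analyzer_pairs_def)
qed

lemma Suc_mod_inj:
  assumes "k < n" "l < n" "Suc k mod n = Suc l mod n"
  shows "k = l"
  using assms by (auto simp: mod_Suc split: if_splits)

lemma distinct_step2: "distinct (pair_modes (step2_pairs n))"
  unfolding step2_pairs_def by (rule distinct_pair_modes_map) presburger+

lemma distinct_step3: "distinct (pair_modes (step3_pairs n))"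
  unfolding step3_pairs_def by (rule distinct_pair_modes_map) auto

lemma distinct_analyzer: "distinct (pair_modes (analyzer_pairs n))"
  unfolding analyzer_pairs_eq
proof (rule distinct_pair_modes_map)
  have odd: "2*n + (2*a+1) \<noteq> 2*n + 2 * b" for a b :: nat
    by presburger
  fix k assume "k < n"
  show "2*n + (2*k+1) \<noteq> 2*n + 2 * (Suc k mod n)"
    by (rule odd)
  fix l assume "l < n" "k \<noteq> l"
  then show "2*n + (2*k+1) \<noteq> 2*n + (2*l+1) \<and> 2*n + (2*k+1) \<noteq> 2*n + 2 * (Suc l mod n) \<and>
      2*n + 2 * (Suc k mod n) \<noteq> 2*n + 2 * (Suc l mod n)"
    using Suc_mod_inj[of k n l] \<open>k < n\<close> odd by auto
qed

lemma protocol_optics_input: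
  "protocol_optics n (input_poly n s) = (\<Prod>j<2*n. lform (s j) (amp n j))"
  unfolding protocol_optics_def input_poly_prod amp_def
proof (rule apply_H_list_prod_lform)
  show "fst pq \<noteq> snd pq" if "pq \<in> set (step2_pairs n @ step3_pairs n @ analyzer_pairs n)" for pq
    using that by (auto simp: step2_pairs_def step3_pairs_def analyzer_pairs_eq
        dest: arg_cong[where f = even])
qed simp

section \<open>Rails, analyzer pairs and the amplitudes between them\<close>

definition rail :: "nat \<Rightarrow> bool \<Rightarrow> nat" where
  "rail k \<sigma> = 2 * k + of_bool \<sigma>"

definition sg :: "bool \<Rightarrow> complex" where
  "sg b = (if b then - 1 else 1)"

text \<open>The mode in which the single photon of the analyzer pair number \<open>g\<close> is detected, and the
  sign with which the second mode of the pair contributes to it.\<close>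

definition click :: "nat \<Rightarrow> (nat \<Rightarrow> nat) \<Rightarrow> nat \<Rightarrow> nat" where
  "click n m g = 2 * n + (if m (2*g+1) = 1 then 2*g+1 else 2 * (Suc g mod n))"

definition click_sg :: "(nat \<Rightarrow> nat) \<Rightarrow> nat \<Rightarrow> complex" where
  "click_sg m g = sg (m (2*g+1) \<noteq> 1)"

text \<open>The analyzer pair fed by mode \<open>rail k \<sigma>\<close>.\<close>

definition grp :: "nat \<Rightarrow> nat \<Rightarrow> bool \<Rightarrow> nat" where
  "grp n k \<sigma> = (if \<sigma> then k else (k + n - 1) mod n)"

text \<open>The factor between the amplitude for the click fed by \<open>rail k \<sigma>\<close> and
  the amplitude for staying on that rail; it is the same for both input photons of the pair. The odd
  rail is the first mode of its analyzer pair and enters both detectors with sign +.\<close>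

definition click_amp :: "nat \<Rightarrow> (nat \<Rightarrow> nat) \<Rightarrow> nat \<Rightarrow> bool \<Rightarrow> complex" where
  "click_amp n m k \<sigma> = (if \<sigma> then 1 else click_sg m (grp n k False)) / complex_of_real (sqrt 2)"

lemma grp_less: "k < n \<Longrightarrow> grp n k \<sigma> < n"
  by (auto simp: grp_def)

lemma grp_False: "k < n \<Longrightarrow> grp n k False = (if k = 0 then n - 1 else k - 1)"
  by (auto simp: grp_def mod_if)

lemma grp_False_iff: "k < n \<Longrightarrow> g < n \<Longrightarrow> grp n k False = g \<longleftrightarrow> Suc g mod n = k"
  by (auto simp: grp_False mod_Suc)

lemma rail_eq_iff [simp]: "rail k \<sigma> = rail l \<tau> \<longleftrightarrow> k = l \<and> \<sigma> = \<tau>"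
  by (auto simp: rail_def of_bool_def split: if_splits; presburger)

lemma rail_less: "k < n \<Longrightarrow> rail k \<sigma> < 2 * n"
  by (auto simp: rail_def)

lemma rail_cases:
  assumes "r < 2 * n"
  obtains k \<sigma> where "k < n" "r = rail k \<sigma>"
proof -
  have "r = rail (r div 2) (odd r)" by (simp add: rail_def)
  moreover have "r div 2 < n" using assms by simp
  ultimately show ?thesis using that by blast
qed

lemma amp_step2:
  assumes "k < n" "l < n"
  shows "fold hact (step2_pairs n) (\<lambda>r. if r = rail k b then 1 else 0) (rail l \<sigma>) =
    (if l = k then sg (\<sigma> \<and> b) / complex_of_real (sqrt 2) else 0)"
proof -
  have "(2*l, 2*l+1) \<in> set (step2_pairs n)" using assms by (auto simp: step2_pairs_def)
  note H = fold_hact_pair[OF distinct_step2 this]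
  have e: "(2 * l = rail k b) = (l = k \<and> \<not> b)" "(2 * l + 1 = rail k b) = (l = k \<and> b)"
    using rail_eq_iff[of l False k b] rail_eq_iff[of l True k b] by (auto simp: rail_def)
  show ?thesis
    using H[of "\<lambda>r. if r = rail k b then 1 else 0"] unfolding e
    by (cases \<sigma>) (auto simp: rail_def[of l] sg_def)
qed

lemma amp_step2_idle:
  assumes "k < n" "r \<ge> 2 * n"
  shows "fold hact (step2_pairs n) (\<lambda>r. if r = rail k b then 1 else 0) r = 0"
  using assms rail_less[of k n b] by (subst fold_hact_idle) (auto simp: step2_pairs_def)

lemma amp_step3:
  assumes "r < 2 * n" "k < n"
  shows "fold hact (step2_pairs n @ step3_pairs n) (\<lambda>r. if r = rail k b then 1 else 0) r =
      fold hact (step2_pairs n) (\<lambda>r. if r = rail k b then 1 else 0) r / complex_of_real (sqrt 2)"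
    and "fold hact (step2_pairs n @ step3_pairs n) (\<lambda>r. if r = rail k b then 1 else 0) (2 * n + r) =
      fold hact (step2_pairs n) (\<lambda>r. if r = rail k b then 1 else 0) r / complex_of_real (sqrt 2)"
proof -
  have "(r, 2*n+r) \<in> set (step3_pairs n)" using assms by (auto simp: step3_pairs_def)
  note H = fold_hact_pair[OF distinct_step3 this]
  show "fold hact (step2_pairs n @ step3_pairs n) (\<lambda>r. if r = rail k b then 1 else 0) r =
      fold hact (step2_pairs n) (\<lambda>r. if r = rail k b then 1 else 0) r / complex_of_real (sqrt 2)"
    and "fold hact (step2_pairs n @ step3_pairs n) (\<lambda>r. if r = rail k b then 1 else 0) (2 * n + r) =
      fold hact (step2_pairs n) (\<lambda>r. if r = rail k b then 1 else 0) r / complex_of_real (sqrt 2)"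
    using amp_step2_idle[of k n "2*n+r" b] assms by (simp_all add: H)
qed

lemma amp_rail:
  assumes "k < n" "l < n"
  shows "amp n (rail k b) (rail l \<sigma>) = (if l = k then sg (\<sigma> \<and> b) / 2 else 0)"
proof -
  have "rail l \<sigma> \<notin> set (pair_modes (analyzer_pairs n))"
    using rail_less[of l n \<sigma>] assms by (auto simp: analyzer_pairs_eq)
  then have "amp n (rail k b) (rail l \<sigma>) =
    fold hact (step2_pairs n @ step3_pairs n) (\<lambda>r. if r = rail k b then 1 else 0) (rail l \<sigma>)"
    by (simp add: amp_def fold_hact_idle)
  also have "\<dots> = (if l = k then sg (\<sigma> \<and> b) / 2 else 0)"
    using assms rail_less[of l n \<sigma>] by (simp add: amp_step3(1) amp_step2 del: fold_append flip: of_real_mult)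
  finally show ?thesis .
qed

text \<open>A photon of input pair \<open>k\<close> reaches analyzer pair \<open>g\<close> through
  its odd rail (\<open>g = k\<close>) or through its even rail; only the odd rail carries the sign
  of the second input. The three beamsplitters on the way give
  \<open>1 / (2 * sqrt 2)\<close>.\<close>

lemma amp_click:
  assumes "k < n" "g < n"
  shows "amp n (rail k b) (click n m g) =
    ((if g = k then sg b else 0) + (if grp n k False = g then click_sg m g else 0))
      / (2 * complex_of_real (sqrt 2))"
proof -
  let ?v = "fold hact (step2_pairs n @ step3_pairs n) (\<lambda>r. if r = rail k b then 1 else 0)"
  have "(2*n + (2*g+1), 2*n + 2 * (Suc g mod n)) \<in> set (analyzer_pairs n)"
    using assms by (auto simp: analyzer_pairs_eq)
  note H = fold_hact_pair[OF distinct_analyzer this]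
  have r: "2*g+1 = rail g True" "2 * (Suc g mod n) = rail (Suc g mod n) False"
    by (simp_all add: rail_def)
  have lt: "Suc g mod n < n" using assms by simp
  have a: "?v (2*n + (2*g+1)) = (if g = k then sg b / 2 else 0)"
    unfolding r using assms rail_less[of g n True]
    by (simp add: amp_step3(2) amp_step2 del: fold_append flip: of_real_mult)
  have c: "?v (2*n + 2 * (Suc g mod n)) = (if grp n k False = g then 1 / 2 else 0)"
    unfolding r using assms rail_less[OF lt, of False] lt
    by (simp add: amp_step3(2) amp_step2 sg_def grp_False_iff del: fold_append flip: of_real_mult)
  have "amp n (rail k b) (click n m g) = (?v (2*n + (2*g+1)) + click_sg m g * ?v (2*n + 2 * (Suc g mod n)))
      / complex_of_real (sqrt 2)"
    using H[of ?v] by (auto simp: amp_def click_def click_sg_def sg_def)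
  then show ?thesis
    unfolding a c by (auto simp: field_simps)
qed

text \<open>With \<open>2 \<le> n\<close> the two rails of a qubit feed different analyzer pairs, so
  exactly one summand of \<open>amp_click\<close> survives.\<close>

lemma amp_click_grp:
  assumes "2 \<le> n" "k < n"
  shows "amp n (rail k b) (click n m (grp n k \<sigma>)) = sg (\<sigma> \<and> b) * click_amp n m k \<sigma> / 2"
  using assms grp_less[of k n \<sigma>]
  by (subst amp_click) (auto simp: grp_def[of n k True] grp_False click_amp_def sg_def)

subsection \<open>Coefficients of products\<close>

lemma lookup_lform_mult:
  assumes "finite {r. v r \<noteq> 0}" "finite {r. v' r \<noteq> 0}"
  shows "Poly_Mapping.lookup (lform t v * lform t' v') M =
    (\<Sum>r\<in>{r. v r \<noteq> 0}. \<Sum>r'\<in>{r. v' r \<noteq> 0}. if M = {#(r, t), (r', t')#} then v r * v' r' else 0)"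
  unfolding lform_def sum_product lookup_sum mult_single
  by (intro sum.cong refl) (auto simp: lookup_single when_def add_mset_commute)

lemma lookup_lform_mult_nonzero:
  assumes "finite {r. v r \<noteq> 0}" "finite {r. v' r \<noteq> 0}"
    and "Poly_Mapping.lookup (lform t v * lform t' v') M \<noteq> 0"
  obtains r r' where "M = {#(r, t), (r', t')#}" "v r \<noteq> 0" "v' r' \<noteq> 0"
  using assms(3) unfolding lookup_lform_mult[OF assms(1,2)]
  by (smt (verit) mem_Collect_eq sum.neutral)

text \<open>Since \<open>p \<noteq> q\<close>, the two modes can be assigned to the two photons in
  two ways: the coefficient is a 2 by 2 permanent whose terms are selected by the internal
  labels.\<close>

lemma lookup_lform_mult_pair:
  assumes fin: "finite {r. v r \<noteq> 0}" "finite {r. v' r \<noteq> 0}" and "p \<noteq> q"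
  shows "Poly_Mapping.lookup (lform t v * lform t' v') {#(p, u), (q, u')#} =
    (if u = t \<and> u' = t' then v p * v' q else 0) + (if u' = t \<and> u = t' then v q * v' p else 0)"
proof -
  have e: "{#(p, u), (q, u')#} = {#(r, t), (r', t')#} \<longleftrightarrow>
      (r = p \<and> r' = q \<and> u = t \<and> u' = t') \<or> (r = q \<and> r' = p \<and> u' = t \<and> u = t')" for r r'
    using \<open>p \<noteq> q\<close> by (auto simp: add_eq_conv_ex)
  have delta2: "(\<Sum>r\<in>A. \<Sum>r'\<in>B. if r = a then if r' = b then c else 0 else 0) =
      (if a \<in> A \<and> b \<in> B then c else 0)" if "finite A" "finite B"
    for A B :: "nat set" and a b and c :: complex
  proof -
    have "(\<Sum>r'\<in>B. if r = a then if r' = b then c else 0 else 0) =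
        (if r = a then if b \<in> B then c else 0 else 0)" for r
      using that by simp
    then show ?thesis using that by simp
  qed
  have "Poly_Mapping.lookup (lform t v * lform t' v') {#(p, u), (q, u')#} =
    (\<Sum>r\<in>{r. v r \<noteq> 0}. \<Sum>r'\<in>{r. v' r \<noteq> 0}.
      (if r = p then if r' = q then if u = t \<and> u' = t' then v p * v' q else 0 else 0 else 0) +
      (if r = q then if r' = p then if u' = t \<and> u = t' then v q * v' p else 0 else 0 else 0))"
    unfolding lookup_lform_mult[OF fin] e using \<open>p \<noteq> q\<close> by (intro sum.cong refl) auto
  also have "\<dots> =
      (if v p \<noteq> 0 \<and> v' q \<noteq> 0 then if u = t \<and> u' = t' then v p * v' q else 0 else 0) +
      (if v q \<noteq> 0 \<and> v' p \<noteq> 0 then if u' = t \<and> u = t' then v q * v' p else 0 else 0)"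
    by (simp only: sum.distrib delta2[OF fin] mem_Collect_eq)
  also have "\<dots> = (if u = t \<and> u' = t' then v p * v' q else 0) + (if u' = t \<and> u = t' then v q * v' p else 0)"
    by (intro arg_cong2[where f = "(+)"]) (auto split: if_splits)
  finally show ?thesis .
qed

lemma lookup_prod:
  fixes Q :: "'i \<Rightarrow> 'a::comm_monoid_add \<Rightarrow>\<^sub>0 'b::comm_semiring_1"
  assumes "finite I"
  shows "Poly_Mapping.lookup (\<Prod>k\<in>I. Q k) N =
    (\<Sum>f\<in>{f \<in> PiE I (\<lambda>k. Poly_Mapping.keys (Q k)). (\<Sum>k\<in>I. f k) = N}.
      \<Prod>k\<in>I. Poly_Mapping.lookup (Q k) (f k))"
proof -
  have s: "(\<Prod>k\<in>I. Poly_Mapping.single (f k) (c k)) = Poly_Mapping.single (\<Sum>k\<in>I. f k) (\<Prod>k\<in>I. c k)"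
    for f :: "'i \<Rightarrow> 'a" and c :: "'i \<Rightarrow> 'b"
    using assms by (induction I rule: finite_induct) (auto simp: mult_single)
  have "(\<Prod>k\<in>I. Q k) =
      (\<Prod>k\<in>I. \<Sum>M\<in>Poly_Mapping.keys (Q k). Poly_Mapping.single M (Poly_Mapping.lookup (Q k) M))"
    by (simp only: poly_mapping_sum_singles)
  also have "\<dots> = (\<Sum>f\<in>PiE I (\<lambda>k. Poly_Mapping.keys (Q k)).
      Poly_Mapping.single (\<Sum>k\<in>I. f k) (\<Prod>k\<in>I. Poly_Mapping.lookup (Q k) (f k)))"
    using assms by (subst prod_sum_PiE) (simp_all add: s)
  finally show ?thesis
    using assms by (simp add: lookup_sum lookup_single when_def sum.If_cases finite_PiE Int_def)
qed

lemma lookup_prod_nonzero: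
  fixes Q :: "'i \<Rightarrow> 'a::comm_monoid_add \<Rightarrow>\<^sub>0 'b::comm_semiring_1"
  assumes "finite I" "Poly_Mapping.lookup (\<Prod>k\<in>I. Q k) N \<noteq> 0"
  obtains f where "(\<Sum>k\<in>I. f k) = N" "\<And>k. k \<in> I \<Longrightarrow> Poly_Mapping.lookup (Q k) (f k) \<noteq> 0"
proof -
  have "{f \<in> PiE I (\<lambda>k. Poly_Mapping.keys (Q k)). (\<Sum>k\<in>I. f k) = N} \<noteq> {}"
    using assms unfolding lookup_prod[OF assms(1)] by (metis (no_types, lifting) sum.empty)
  then show ?thesis using that by (auto simp: PiE_def Pi_def in_keys_iff)
qed

text \<open>Uniqueness is asked only of splittings of \<open>N\<close> with all coefficients
  nonzero. If \<open>f\<close> itself has a zero coefficient, no splitting contributes and both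
  sides are 0.\<close>

lemma lookup_prod_unique:
  fixes Q :: "'i \<Rightarrow> 'a::comm_monoid_add \<Rightarrow>\<^sub>0 'b::comm_semiring_1"
  assumes I: "finite I" and f: "(\<Sum>k\<in>I. f k) = N"
    and uniq: "\<And>h k. (\<Sum>k\<in>I. h k) = N \<Longrightarrow> (\<And>k. k \<in> I \<Longrightarrow> Poly_Mapping.lookup (Q k) (h k) \<noteq> 0) \<Longrightarrow>
      k \<in> I \<Longrightarrow> h k = f k"
  shows "Poly_Mapping.lookup (\<Prod>k\<in>I. Q k) N = (\<Prod>k\<in>I. Poly_Mapping.lookup (Q k) (f k))"
proof -
  let ?X = "{h \<in> PiE I (\<lambda>k. Poly_Mapping.keys (Q k)). (\<Sum>k\<in>I. h k) = N}"
  have sub: "h = restrict f I" if "h \<in> ?X" for h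
    using that uniq[of h] by (auto simp: PiE_def Pi_def in_keys_iff extensional_def fun_eq_iff)
  show ?thesis
  proof (cases "\<forall>k\<in>I. Poly_Mapping.lookup (Q k) (f k) \<noteq> 0")
    case True
    then have "restrict f I \<in> ?X" using f by (auto simp: in_keys_iff)
    then have "?X = {restrict f I}" using sub by blast
    then show ?thesis unfolding lookup_prod[OF I] by simp
  next
    case False
    then have "restrict f I \<notin> ?X" by (auto simp: in_keys_iff PiE_def Pi_def)
    then have "?X = {}" using sub by blast
    moreover have "(\<Prod>k\<in>I. Poly_Mapping.lookup (Q k) (f k)) = 0"
      using False I by (auto intro!: prod_zero)
    ultimately show ?thesis unfolding lookup_prod[OF I] by (simp only: sum.empty)
  qed
qed

subsection \<open>Photon counting\<close>

lemma mc_add [simp]: "mc (A + B) q = mc A q + mc B q"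
  by (simp add: mc_def)

lemma mc_sum: "mc (\<Sum>k\<in>I. f k) q = (\<Sum>k\<in>I. mc (f k) q)"
  by (induction I rule: infinite_finite_induct) (auto simp: mc_def)

lemma mc_add_mset [simp]: "mc (add_mset l A) q = of_bool (fst l = q) + mc A q"
  by (simp add: mc_def)

lemma mc_empty [simp]: "mc {#} q = 0"
  by (simp add: mc_def)

lemma mc_eq_0_iff: "mc A q = 0 \<longleftrightarrow> (\<forall>l\<in>#A. fst l \<noteq> q)"
  by (auto simp: mc_def filter_mset_eq_mempty_iff)

lemma mc_image_mset_set:
  "finite I \<Longrightarrow> mc (image_mset f (mset_set I)) q = card {k \<in> I. fst (f k) = q}"
  by (simp add: mc_def filter_mset_image_mset o_def)

lemma sum_of_bool_eq_1D:
  fixes n :: nat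
  assumes "(\<Sum>k<n. of_bool (P k) :: nat) = 1"
  shows "\<exists>k<n. P k" and "\<And>k l. k < n \<Longrightarrow> l < n \<Longrightarrow> P k \<Longrightarrow> P l \<Longrightarrow> k = l"
proof -
  have "card {k. k < n \<and> P k} = 1"
    using assms sum.inter_filter[OF finite_lessThan, of "\<lambda>_. 1 :: nat" n P] by (simp add: of_bool_def)
  then obtain x where x: "{k. k < n \<and> P k} = {x}" by (rule card_1_singletonE)
  then show "\<exists>k<n. P k" by blast
  show "k = l" if "k < n" "l < n" "P k" "P l" for k l
  proof -
    have "k \<in> {k. k < n \<and> P k}" "l \<in> {k. k < n \<and> P k}" using that by simp_all
    then show ?thesis unfolding x by simp
  qed
qed

section \<open>Successful analyzer patterns and the clicks they record\<close>

locale analyzer_run =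
  fixes n i :: nat and m :: "nat \<Rightarrow> nat"
  assumes n2: "2 \<le> n" and i_less: "i < n" and success: "analyzer_success n m"
begin

lemma success_pair: "g < n \<Longrightarrow> m (2*g+1) + m (2 * (Suc g mod n)) = 1"
  using success mult_mod_right[of 2 "Suc g" n] by (simp add: analyzer_success_def)

lemma click_inj: "click n m g = click n m g' \<Longrightarrow> g < n \<Longrightarrow> g' < n \<Longrightarrow> g = g'"
  using Suc_mod_inj[of g n g']
  by (auto simp: click_def split: if_splits dest: arg_cong[where f = even])

lemma click_ge: "2 * n \<le> click n m g"
  by (simp add: click_def)

lemma click_less: "g < n \<Longrightarrow> click n m g < 4 * n"
  using mod_less_divisor[of n "Suc g"] by (auto simp: click_def simp del: mod_less_divisor)

lemma rail_neq_click [simp]: "k < n \<Longrightarrow> rail k \<sigma> \<noteq> click n m g" "k < n \<Longrightarrow> click n m g \<noteq> rail k \<sigma>"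
  using rail_less[of k n \<sigma>] click_ge[of g] by auto

lemma grp_neq: "k < n \<Longrightarrow> grp n k True \<noteq> grp n k False"
  using n2 by (auto simp: grp_def[of n k True] grp_False)

text \<open>Every analyzer mode belongs to exactly one analyzer pair, and success puts a single
  photon into each pair; the pattern is therefore equivalent to the list of clicked modes.\<close>

lemma count_click:
  assumes "j < 2 * n"
  shows "m j = of_bool (\<exists>g<n. click n m g = 2 * n + j)"
proof -
  obtain k \<sigma> where k: "k < n" and j: "j = rail k \<sigma>" using rail_cases[OF assms] .
  define g where "g = grp n k \<sigma>"
  have g: "g < n" using k by (simp add: g_def grp_less)
  have jg: "if \<sigma> then j = 2*g+1 else j = 2 * (Suc g mod n)"
    using grp_False_iff[OF k g] by (auto simp: g_def j rail_def grp_def[of n k True])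
  have iff: "g' = g" if "g' < n" "click n m g' = 2 * n + j" for g'
  proof (rule ccontr)
    assume "g' \<noteq> g"
    then show False using that jg Suc_mod_inj[of g' n g] g
      by (auto simp: click_def split: if_splits dest: arg_cong[where f = even])
  qed
  have "m j = of_bool (click n m g = 2 * n + j)"
    using success_pair[OF g] jg
    by (cases \<sigma>) (auto simp: click_def of_bool_def dest: arg_cong[where f = even])
  moreover have "(\<exists>g<n. click n m g = 2 * n + j) \<longleftrightarrow> click n m g = 2 * n + j"
    using iff g by blast
  ultimately show ?thesis by simp
qed

lemma mc_meas_click:
  assumes "A \<in> meas_set n m" "g < n"
  shows "mc A (click n m g) = 1"
proof -
  define j where "j = click n m g - 2 * n"
  have j: "click n m g = 2 * n + j" "j < 2 * n"
    using click_ge[of g] click_less[OF assms(2)] by (auto simp: j_def)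
  then have "mc A (click n m g) = m j" using assms by (simp add: meas_set_def)
  then show ?thesis using count_click[OF j(2)] j assms(2) by auto
qed

lemma meas_labelE:
  assumes "A \<in> meas_set n m" "l \<in># A"
  obtains g where "g < n" "fst l = click n m g"
proof -
  define j where "j = fst l - 2 * n"
  have j: "fst l = 2 * n + j" "j < 2 * n"
    using assms by (auto simp: j_def meas_set_def)
  have "mc A (2 * n + j) \<noteq> 0" using assms(2) j by (auto simp: mc_eq_0_iff)
  then have "m j \<noteq> 0" using assms(1) j by (auto simp: meas_set_def)
  then show ?thesis using that count_click[OF j(2)] j by auto
qed

section \<open>Fock states that can survive a successful measurement\<close>

definition out_fock :: "bool \<Rightarrow> bool \<Rightarrow> bool \<Rightarrow> fock" where
  "out_fock \<sigma> \<tau> t = image_mset (\<lambda>k. (rail k (if k = i then \<tau> else \<sigma>), k = i \<and> t)) (mset_set {..<n})"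

definition click_fock :: "bool \<Rightarrow> bool \<Rightarrow> fock" where
  "click_fock \<sigma> u = image_mset (\<lambda>k. (click n m (grp n k \<sigma>), k = i \<and> u)) (mset_set {..<n})"

text \<open>The share of factor \<open>k\<close> in the outcome: one outgoing and one detected
  photon. Only factor \<open>i\<close> may split them over different sides or carry the label
  \<open>\<psi>\<^sub>1\<close>.\<close>

definition pair_fock :: "bool \<Rightarrow> bool \<Rightarrow> bool \<Rightarrow> bool \<Rightarrow> nat \<Rightarrow> fock" where
  "pair_fock \<sigma> \<tau> t u k =
     {#(rail k (if k = i then \<tau> else \<sigma>), k = i \<and> t), (click n m (grp n k \<sigma>), k = i \<and> u)#}"

lemma sum_pair_fock: "(\<Sum>k<n. pair_fock \<sigma> \<tau> t u k) = click_fock \<sigma> u + out_fock \<sigma> \<tau> t"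
proof -
  have "(\<Sum>k<N. {#f k, h k#}) = image_mset h (mset_set {..<N}) + image_mset f (mset_set {..<N})"
    for N and f h :: "nat \<Rightarrow> label"
    by (induction N) (auto simp: lessThan_Suc)
  then show ?thesis unfolding pair_fock_def click_fock_def out_fock_def .
qed

lemma out_fock_modes: "\<forall>l\<in>#out_fock \<sigma> \<tau> t. fst l < 2 * n"
  by (auto simp: out_fock_def rail_less)

lemma grp_inj: "grp n k \<sigma> = grp n l \<sigma> \<Longrightarrow> k < n \<Longrightarrow> l < n \<Longrightarrow> k = l"
  by (cases \<sigma>) (auto simp: grp_def[of n _ True] grp_False split: if_splits)

lemma grp_surj: 
  assumes "g < n" obtains k where "k < n" "grp n k \<sigma> = g"
proof (cases \<sigma>)
  case True
  then show ?thesis using that[of g] assms by (simp add: grp_def)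
next
  case False
  then show ?thesis using that[of "Suc g mod n"] assms by (simp add: grp_False_iff)
qed

text \<open>For a fixed side, \<open>grp\<close> is a bijection from qubits to analyzer pairs, so
  every pair clicks exactly once.\<close>

lemma click_fock_in_meas: "click_fock \<sigma> u \<in> meas_set n m"
proof -
  have "mc (click_fock \<sigma> u) (2*n+j) = m j" if "j < 2 * n" for j
  proof (cases "\<exists>g<n. click n m g = 2 * n + j")
    case True
    then obtain g where g: "g < n" "click n m g = 2 * n + j" by blast
    obtain k where k: "k < n" "grp n k \<sigma> = g" using grp_surj[OF g(1)] .
    have "l = k" if "l < n" "click n m (grp n l \<sigma>) = 2 * n + j" for l
      using grp_inj[of l \<sigma> k] click_inj[of "grp n l \<sigma>" g] grp_less[of l n \<sigma>] that g k by simp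
    then have "{l \<in> {..<n}. click n m (grp n l \<sigma>) = 2 * n + j} = {k}"
      using g k by blast
    then show ?thesis using True count_click[OF that] 
      by (simp add: click_fock_def mc_image_mset_set)
  next
    case False
    then have "{l \<in> {..<n}. click n m (grp n l \<sigma>) = 2 * n + j} = {}"
      using grp_less by auto
    then have "mc (click_fock \<sigma> u) (2*n+j) = 0"
      by (simp only: click_fock_def mc_image_mset_set finite_lessThan fst_conv card.empty)
    then show ?thesis using False count_click[OF that] by simp
  qed
  moreover have "\<forall>l\<in>#click_fock \<sigma> u. 2*n \<le> fst l \<and> fst l < 4*n"
    by (auto simp: click_fock_def click_ge click_less grp_less)
  ultimately show ?thesis by (simp add: meas_set_def)
qed

text \<open>Measured photons sit in modes from \<open>2 * n\<close> on and output photons below, so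
  filtering by mode recovers both parts.\<close>

lemma meas_out_unique:
  assumes "A + R = A' + R'" "A \<in> meas_set n m" "A' \<in> meas_set n m"
    and "\<forall>l\<in>#R. fst l < 2 * n" "\<forall>l\<in>#R'. fst l < 2 * n"
  shows "A = A'" "R = R'"
proof -
  have f: "filter_mset (\<lambda>l. fst l < 2 * n) (A + R) = R" if "A \<in> meas_set n m" 
    "\<forall>l\<in>#R. fst l < 2 * n" for A R :: fock
  proof -
    have "filter_mset (\<lambda>l. fst l < 2 * n) A = {#}"
      using that(1) by (force simp: filter_mset_eq_mempty_iff meas_set_def)
    moreover have "filter_mset (\<lambda>l. fst l < 2 * n) R = R"
      using that(2) by (simp add: filter_mset_eq_conv)
    ultimately show ?thesis by simp
  qed
  show "R = R'" using f[OF assms(2,4)] f[OF assms(3,5)] assms(1) by metis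
  then show "A = A'" using assms(1) by simp
qed

lemma mem_out_fock:
  "(rail k s, b) \<in># out_fock \<sigma> \<tau> t \<longleftrightarrow> k < n \<and> s = (if k = i then \<tau> else \<sigma>) \<and> b = (k = i \<and> t)"
  by (auto simp: out_fock_def image_iff)

lemma mc_out_fock:
  assumes "k < n"
  shows "mc (out_fock \<sigma> \<tau> t) (rail k s) = of_bool (s = (if k = i then \<tau> else \<sigma>))"
proof -
  have "{l \<in> {..<n}. rail l (if l = i then \<tau> else \<sigma>) = rail k s} =
      (if s = (if k = i then \<tau> else \<sigma>) then {k} else {})"
    using assms by auto
  then show ?thesis by (simp add: out_fock_def mc_image_mset_set)
qed

lemma out_fock_inj:
  assumes "out_fock \<sigma> \<tau> t = out_fock \<sigma>' \<tau>' t'"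
  shows "\<sigma> = \<sigma>'" "\<tau> = \<tau>'" "t = t'"
proof -
  \<comment> \<open>A qubit other than \<open>i\<close>, whose rail displays
    \<open>\<sigma>\<close>.\<close>
  define k where "k = (if i = 0 then 1 else 0 :: nat)"
  have k: "k < n" "k \<noteq> i" using n2 by (auto simp: k_def)
  show "\<sigma> = \<sigma>'" using mem_out_fock[of k \<sigma> False \<sigma> \<tau> t] mem_out_fock[of k \<sigma> False \<sigma>' \<tau>' t'] k assms
    by simp
  show "\<tau> = \<tau>'" "t = t'"
    using mem_out_fock[of i \<tau> t \<sigma> \<tau> t] mem_out_fock[of i \<tau> t \<sigma>' \<tau>' t'] i_less assms by simp_all
qed

lemma click_fock_label: "click_fock \<sigma> u = click_fock \<sigma>' u' \<Longrightarrow> u = u'"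
proof -
  have "(\<exists>l\<in>#click_fock \<sigma> u. snd l) \<longleftrightarrow> u" for \<sigma> u
    using i_less by (auto simp: click_fock_def)
  then show "click_fock \<sigma> u = click_fock \<sigma>' u' \<Longrightarrow> u = u'" by metis
qed

lemma dual_rail_out_fock: "dual_rail n (out_fock \<sigma> \<tau> t)"
proof -
  have "mc (out_fock \<sigma> \<tau> t) (2*k) + mc (out_fock \<sigma> \<tau> t) (2*k+1) = 1" if "k < n" for k
    using mc_out_fock[OF that, of \<sigma> \<tau> t False] mc_out_fock[OF that, of \<sigma> \<tau> t True]
    by (auto simp: rail_def)
  then show ?thesis by (simp add: dual_rail_def)
qed

text \<open>Every click is produced by exactly one photon; going once around the cycle of analyzer pairs
  this forces all measured photons onto the same side.\<close>

lemma side_constant: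
  assumes "\<And>g. g < n \<Longrightarrow> (\<Sum>k<n. of_bool (grp n k (S k) = g) :: nat) = 1" "k < n"
  shows "S k = S 0"
  using assms(2)
proof (induction k)
  case (Suc k)
  have k: "k < n" "Suc k < n" using Suc.prems by auto
  have iff: "grp n l (S l) = k \<longleftrightarrow> (if S l then l = k else l = Suc k)" if "l < n" for l
    using that k grp_False_iff[OF that k(1)] by (auto simp: grp_def[of n l True])
  have "S (Suc k) = S k"
  \<comment> \<open>Analyzer pair \<open>k\<close> is fed by the odd rail of qubit \<open>k\<close>
    and the even rail of qubit \<open>k + 1\<close>. If qubit \<open>k\<close> supplies its click,
    qubit \<open>k + 1\<close> must avoid it; otherwise qubit \<open>k + 1\<close> must supply
    it.\<close>
  proof (cases "S k")
    case True
    then show ?thesis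
      using sum_of_bool_eq_1D(2)[OF assms(1)[OF k(1)] k] iff[OF k(1)] iff[OF k(2)]
      by (metis n_not_Suc_n)
  next
    case False
    then show ?thesis
      using sum_of_bool_eq_1D(1)[OF assms(1)[OF k(1)]] iff by (metis n_not_Suc_n)
  qed
  then show ?case using Suc.IH k by simp
qed simp

section \<open>The quadratic factor of one input pair\<close>

definition pair_poly :: "(nat \<Rightarrow> bool) \<Rightarrow> nat \<Rightarrow> cpoly" where
  "pair_poly s k = lform (s (rail k False)) (amp n (rail k False)) *
     lform (s (rail k True)) (amp n (rail k True))"

lemma protocol_optics_pair_poly:
  "protocol_optics n (input_poly n s) = (\<Prod>k<n. pair_poly s k)"
proof -
  have "(\<Prod>j<2*N. lform (s j) (amp n j)) = (\<Prod>k<N. pair_poly s k)" for N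
    by (induction N) (auto simp: pair_poly_def rail_def mult_ac)
  then show ?thesis by (simp add: protocol_optics_input)
qed

text \<open>One name for the four visible modes open to factor \<open>k\<close>, with
  \<open>z\<close> telling detection from output, so that a single formula covers all placements of
  its two photons.\<close>

definition port :: "nat \<Rightarrow> bool \<Rightarrow> bool \<Rightarrow> nat" where
  "port k \<sigma> z = (if z then click n m (grp n k \<sigma>) else rail k \<sigma>)"

lemma amp_port:
  "k < n \<Longrightarrow> amp n (rail k b) (port k \<sigma> z) = sg (\<sigma> \<and> b) * (if z then click_amp n m k \<sigma> else 1) / 2"
  by (simp add: port_def amp_rail amp_click_grp n2)

lemma port_eq_iff: "k < n \<Longrightarrow> port k \<sigma> z = port k \<sigma>' z' \<longleftrightarrow> \<sigma> = \<sigma>' \<and> z = z'"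
  using grp_neq[of k] click_inj[of "grp n k \<sigma>" "grp n k \<sigma>'"] grp_less[of k n]
  by (cases \<sigma>; cases \<sigma>') (auto simp: port_def)

text \<open>The two terms match the two photons to the two ports; the photon that entered the odd
  mode brings the sign of its side. For equal labels on opposite sides they cancel, which is the
  Hong-Ou-Mandel effect.\<close>

lemma lookup_pair_poly:
  assumes "k < n" "\<sigma> \<noteq> \<sigma>' \<or> z \<noteq> z'"
  shows "Poly_Mapping.lookup (pair_poly s k) {#(port k \<sigma> z, t), (port k \<sigma>' z', u)#} =
    (of_bool (t = s (rail k False) \<and> u = s (rail k True)) * sg \<sigma>' +
     of_bool (u = s (rail k False) \<and> t = s (rail k True)) * sg \<sigma>) *
    (if z then click_amp n m k \<sigma> else 1) * (if z' then click_amp n m k \<sigma>' else 1) / 4"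
proof -
  have "port k \<sigma> z \<noteq> port k \<sigma>' z'" using assms by (simp add: port_eq_iff)
  note L = lookup_lform_mult_pair[OF finite_support_amp finite_support_amp this]
  have "sg False = 1" by (simp add: sg_def)
  moreover define H where "H = (if z then click_amp n m k \<sigma> else 1)"
  moreover define H' where "H' = (if z' then click_amp n m k \<sigma>' else 1)"
  moreover define b where "b \<longleftrightarrow> t = s (rail k False) \<and> u = s (rail k True)"
  moreover define b' where "b' \<longleftrightarrow> u = s (rail k False) \<and> t = s (rail k True)"
  ultimately show ?thesis
    unfolding pair_poly_def L amp_port[OF assms(1)] H_def[symmetric] H'_def[symmetric]
      b_def[symmetric] b'_def[symmetric]
    by (cases b; cases b') (simp_all add: algebra_simps add_divide_distrib)
qed

text \<open>A photon of pair \<open>k\<close> reaches only its own rails and the analyzer pairs fed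
  by them, hence only ports; equal internal states force equal sides by the cancellation in
  \<open>lookup_pair_poly\<close>.\<close>

lemma pair_poly_nonzero:
  assumes k: "k < n" and nz: "Poly_Mapping.lookup (pair_poly s k) M \<noteq> 0"
    and modes: "\<And>l. l \<in># M \<Longrightarrow> fst l < 2 * n \<or> (\<exists>g<n. fst l = click n m g)"
  obtains \<sigma> z \<sigma>' z' where "M = {#(port k \<sigma> z, s (rail k False)), (port k \<sigma>' z', s (rail k True))#}"
    and "s (rail k False) = s (rail k True) \<Longrightarrow> \<sigma> = \<sigma>'"
proof -
  obtain r r' where M: "M = {#(r, s (rail k False)), (r', s (rail k True))#}"
    and r: "amp n (rail k False) r \<noteq> 0" "amp n (rail k True) r' \<noteq> 0"
    using nz lookup_lform_mult_nonzero[OF finite_support_amp finite_support_amp]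
    unfolding pair_poly_def by metis
  have port: "\<exists>\<sigma> z. r = port k \<sigma> z" if "amp n (rail k b) r \<noteq> 0" "r < 2 * n \<or> (\<exists>g<n. r = click n m g)"
    for r b
    using that(2)
  proof
    assume "r < 2 * n"
    then obtain l \<sigma> where l: "l < n" "r = rail l \<sigma>" by (rule rail_cases)
    then have "l = k" using that(1) k by (auto simp: amp_rail split: if_splits)
    then show ?thesis using l by (auto simp: port_def)
  next
    assume "\<exists>g<n. r = click n m g"
    then obtain g where g: "g < n" "r = click n m g" by blast
    then have "grp n k True = g \<or> grp n k False = g"
      using that(1) k by (auto simp: amp_click grp_def[of n k True] split: if_splits)
    then show ?thesis using g by (auto simp: port_def)
  qed
  obtain \<sigma> z where 1: "r = port k \<sigma> z" using port[OF r(1)] modes[of "(r, s (rail k False))"] M by auto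
  obtain \<sigma>' z' where 2: "r' = port k \<sigma>' z'" using port[OF r(2)] modes[of "(r', s (rail k True))"] M by auto
  have "\<sigma> = \<sigma>'" if "s (rail k False) = s (rail k True)"
  proof (rule ccontr)
    assume "\<sigma> \<noteq> \<sigma>'"
    then have "Poly_Mapping.lookup (pair_poly s k) M = 0"
      unfolding M 1 2 using k that by (subst lookup_pair_poly) (auto simp: sg_def)
    then show False using nz by simp
  qed
  then show ?thesis using that M 1 2 by blast
qed

text \<open>The flags \<open>z k\<close> and \<open>z' k\<close> record which photons of factor
  \<open>k\<close> are detected. Once each factor is shown to have exactly one detected photon,
  \<open>side_constant\<close> yields the common side, and only factor \<open>i\<close> keeps any
  freedom.\<close>

lemma pairs_of_outcome:
  assumes s: "\<forall>j. s j \<longrightarrow> j = 2*i \<or> j = 2*i+1"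
    and A: "A \<in> meas_set n m" and R: "\<forall>l\<in>#R. fst l < 2 * n"
    and dr: "dual_rail n R \<or> s (2*i) = s (2*i+1)"
    and h: "(\<Sum>k<n. h k) = A + R"
    and nz: "\<And>k. k < n \<Longrightarrow> Poly_Mapping.lookup (pair_poly s k) (h k) \<noteq> 0"
  obtains \<sigma> \<tau> t u where "\<forall>k<n. h k = pair_fock \<sigma> \<tau> t u k"
proof -
  have modes: "fst l < 2 * n \<or> (\<exists>g<n. fst l = click n m g)" if "k < n" "l \<in># h k" for k l
  proof -
    have "l \<in># A + R" unfolding h[symmetric] using that by (auto simp: set_mset_sum)
    then show ?thesis using R meas_labelE[OF A] by (metis union_iff)
  qed
  have "\<exists>\<sigma> z \<sigma>' z'. h k = {#(port k \<sigma> z, s (rail k False)), (port k \<sigma>' z', s (rail k True))#} \<and>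
      (s (rail k False) = s (rail k True) \<longrightarrow> \<sigma> = \<sigma>')" if "k < n" for k
    using pair_poly_nonzero[OF that nz[OF that] modes[OF that]] by metis
  then obtain \<sigma> z \<sigma>' z' where hk: "\<And>k. k < n \<Longrightarrow>
        h k = {#(port k (\<sigma> k) (z k), s (rail k False)), (port k (\<sigma>' k) (z' k), s (rail k True))#}"
    and side: "\<And>k. k < n \<Longrightarrow> s (rail k False) = s (rail k True) \<Longrightarrow> \<sigma> k = \<sigma>' k"
    by metis
  have sF: "\<not> s (rail k b)" if "k \<noteq> i" for k b
    using s[rule_format, of "rail k b"] rail_eq_iff[of k b i False] rail_eq_iff[of k b i True] that
    by (auto simp: rail_def)
  have port_click: "port k \<sigma> z = click n m g \<longleftrightarrow> z \<and> grp n k \<sigma> = g" if "k < n" "g < n" for k \<sigma> z g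
    using that click_inj[of "grp n k \<sigma>" g] grp_less[of k n \<sigma>] by (auto simp: port_def)
  have port_rail: "port k \<sigma> z = rail l b \<longleftrightarrow> \<not> z \<and> k = l \<and> \<sigma> = b" if "k < n" "l < n" for k l \<sigma> z b
    using that by (auto simp: port_def)
  have clicks: "(\<Sum>k<n. of_bool (z k \<and> grp n k (\<sigma> k) = g) + of_bool (z' k \<and> grp n k (\<sigma>' k) = g)) = (1 :: nat)"
    if "g < n" for g
  proof -
    have "mc R (click n m g) = 0" using R click_ge[of g] by (fastforce simp: mc_eq_0_iff)
    then have "1 = mc (\<Sum>k<n. h k) (click n m g)" using mc_meas_click[OF A that] h by simp
    also have "\<dots> = (\<Sum>k<n. of_bool (z k \<and> grp n k (\<sigma> k) = g) + of_bool (z' k \<and> grp n k (\<sigma>' k) = g))"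
      unfolding mc_sum using that by (intro sum.cong refl) (simp add: hk port_click)
    finally show ?thesis ..
  qed
  have one: "z' k = (\<not> z k)" if k: "k < n" for k
    using dr
  proof
    \<comment> \<open>Only factor \<open>k\<close> reaches the rails of qubit \<open>k\<close>, and
      measured photons are elsewhere; one photon on these rails leaves the other to be
      detected.\<close>
    assume "dual_rail n R"
    have "mc A (rail k b) = 0" for b
      using A rail_less[OF k, of b] by (fastforce simp: mc_eq_0_iff meas_set_def)
    moreover have "mc R (rail k False) + mc R (rail k True) = 1"
      using \<open>dual_rail n R\<close> k by (simp add: dual_rail_def rail_def)
    ultimately have "1 = mc (\<Sum>l<n. h l) (rail k False) + mc (\<Sum>l<n. h l) (rail k True)"
      unfolding h using \<open>mc R (rail k False) + mc R (rail k True) = 1\<close> by simp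
    also have "\<dots> = (\<Sum>l<n. if l = k then of_bool (\<not> z k) + of_bool (\<not> z' k) else 0)"
      unfolding mc_sum sum.distrib[symmetric] using k
      by (intro sum.cong refl) (auto simp: hk port_rail)
    finally show ?thesis using k by (cases "z k"; cases "z' k") auto
  next
    assume "s (2*i) = s (2*i+1)"
    then have "s (rail k False) = s (rail k True)" if "k < n" for k
      using sF[of k False] sF[of k True] by (cases "k = i") (auto simp: rail_def)
    then have same: "\<sigma> k = \<sigma>' k" if "k < n" for k
      using side that by blast
    \<comment> \<open>Two detected photons of one factor would lie on the same side and hit the same
      analyzer pair, which clicks only once. So each of the \<open>n\<close> factors yields at most
      one click, and since there are \<open>n\<close> clicks in all, exactly one.\<close>
    let ?e = "\<lambda>k. of_bool (z k) + of_bool (z' k) :: nat"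
    have le: "?e k \<le> 1" if "k < n" for k
    proof (rule ccontr)
      assume "\<not> ?e k \<le> 1"
      then have "z k" "z' k" by (auto simp: of_bool_def split: if_splits)
      let ?g = "grp n k (\<sigma> k)"
      have "2 = of_bool (z k \<and> grp n k (\<sigma> k) = ?g) + (of_bool (z' k \<and> grp n k (\<sigma>' k) = ?g) :: nat)"
        using \<open>z k\<close> \<open>z' k\<close> same[OF that] by simp
      also have "\<dots> \<le> (\<Sum>k<n. of_bool (z k \<and> grp n k (\<sigma> k) = ?g) + of_bool (z' k \<and> grp n k (\<sigma>' k) = ?g))"
        by (rule member_le_sum) (use that in auto)
      finally show False using clicks[OF grp_less[OF that]] by simp
    qed
    have inner: "(\<Sum>g<n. of_bool (b \<and> grp n k \<sigma> = g) :: nat) = of_bool b" if "k < n" for b k \<sigma>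
      using grp_less[OF that, of \<sigma>] by (cases b) (auto simp: of_bool_def)
    have "n = (\<Sum>g<n. \<Sum>k<n. of_bool (z k \<and> grp n k (\<sigma> k) = g) + of_bool (z' k \<and> grp n k (\<sigma>' k) = g))"
      by (simp add: clicks)
    also have "\<dots> = (\<Sum>k<n. ?e k)"
      by (subst sum.swap, intro sum.cong refl) (simp only: sum.distrib inner lessThan_iff)
    finally have "(\<Sum>k<n. ?e k) = (\<Sum>k<n. 1)" by simp
    then have "?e k = 1"
      using sum_strict_mono_ex1[of "{..<n}" ?e "\<lambda>_. 1"] le k
      by (metis finite_lessThan lessThan_iff nat_less_le)
    then show ?thesis by (cases "z k"; cases "z' k") auto
  qed
  \<comment> \<open>\<open>S\<close> and \<open>u\<close> are side and label of the detected photon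
    of each factor, \<open>T\<close> and \<open>t\<close> those of the outgoing one.\<close>
  define S where "S k = (if z k then \<sigma> k else \<sigma>' k)" for k
  define T where "T k = (if z k then \<sigma>' k else \<sigma> k)" for k
  define u where "u k = (if z k then s (rail k False) else s (rail k True))" for k
  define t where "t k = (if z k then s (rail k True) else s (rail k False))" for k
  have "(\<Sum>k<n. of_bool (grp n k (S k) = g) :: nat) = 1" if "g < n" for g
    unfolding clicks[OF that, symmetric] by (intro sum.cong refl) (auto simp: S_def one)
  then have S: "S k = S 0" if "k < n" for k
    using that by (rule side_constant)
  have "h k = pair_fock (S 0) (T i) (t i) (u i) k" if k: "k < n" for k
  proof -
    have "h k = {#(rail k (T k), t k), (click n m (grp n k (S k)), u k)#}"
      using k by (cases "z k") (auto simp: hk one port_def S_def T_def t_def u_def add_mset_commute)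
    \<comment> \<open>Away from \<open>i\<close> both photons are in \<open>\<psi>\<^sub>0\<close>,
      so the cancellation puts them on the same side.\<close>
    moreover have "T k = S k \<and> \<not> t k \<and> \<not> u k" if "k \<noteq> i"
      using side[OF k] sF[OF that] by (simp add: S_def T_def t_def u_def)
    ultimately show ?thesis using S[OF k] by (cases "k = i") (auto simp: pair_fock_def)
  qed
  then show ?thesis using that by blast
qed

text \<open>Every contributing splitting consists of \<open>pair_fock\<close> terms, whose
  parameters can be read off the total: \<open>\<sigma>\<close>, \<open>\<tau>\<close>,
  \<open>t\<close> from the output part and \<open>u\<close> from the clicks. So no two splittings
  interfere.\<close>

lemma lookup_protocol_outcome:
  assumes s: "\<forall>j. s j \<longrightarrow> j = 2*i \<or> j = 2*i+1"
  shows "Poly_Mapping.lookup (protocol_optics n (input_poly n s)) (click_fock \<sigma> u + out_fock \<sigma> \<tau> t) =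
    (\<Prod>k<n. Poly_Mapping.lookup (pair_poly s k) (pair_fock \<sigma> \<tau> t u k))"
  unfolding protocol_optics_pair_poly
proof (rule lookup_prod_unique)
  fix h k
  assume h: "(\<Sum>k<n. h k) = click_fock \<sigma> u + out_fock \<sigma> \<tau> t"
    and nz: "\<And>k. k \<in> {..<n} \<Longrightarrow> Poly_Mapping.lookup (pair_poly s k) (h k) \<noteq> 0" and k: "k \<in> {..<n}"
  have dr: "dual_rail n (out_fock \<sigma> \<tau> t) \<or> s (2*i) = s (2*i+1)"
    by (simp add: dual_rail_out_fock)
  have nz': "Poly_Mapping.lookup (pair_poly s k) (h k) \<noteq> 0" if "k < n" for k
    using nz that by simp
  obtain \<sigma>' \<tau>' t' u' where hk: "\<forall>k<n. h k = pair_fock \<sigma>' \<tau>' t' u' k"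
    by (rule pairs_of_outcome[OF s click_fock_in_meas out_fock_modes dr h nz'])
  have "(\<Sum>k<n. h k) = click_fock \<sigma>' u' + out_fock \<sigma>' \<tau>' t'"
    unfolding sum_pair_fock[symmetric] by (simp add: hk)
  then have eq: "click_fock \<sigma> u + out_fock \<sigma> \<tau> t = click_fock \<sigma>' u' + out_fock \<sigma>' \<tau>' t'"
    using h by simp
  note * = meas_out_unique[OF eq click_fock_in_meas click_fock_in_meas out_fock_modes out_fock_modes]
  show "h k = pair_fock \<sigma> \<tau> t u k"
    using hk k out_fock_inj[OF *(2)] click_fock_label[OF *(1)] by simp
qed (simp_all add: sum_pair_fock)

lemma outcome_support:
  assumes s: "\<forall>j. s j \<longrightarrow> j = 2*i \<or> j = 2*i+1"
    and A: "A \<in> meas_set n m" and R: "\<forall>l\<in>#R. fst l < 2 * n"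
    and dr: "dual_rail n R \<or> s (2*i) = s (2*i+1)"
    and nz: "Poly_Mapping.lookup (protocol_optics n (input_poly n s)) (A + R) \<noteq> 0"
  obtains \<sigma> \<tau> t u where "A = click_fock \<sigma> u" "R = out_fock \<sigma> \<tau> t"
proof -
  obtain h where h: "(\<Sum>k<n. h k) = A + R"
    and hnz: "\<And>k. k < n \<Longrightarrow> Poly_Mapping.lookup (pair_poly s k) (h k) \<noteq> 0"
    using lookup_prod_nonzero[OF _ nz[unfolded protocol_optics_pair_poly]] by auto
  obtain \<sigma> \<tau> t u where hk: "\<forall>k<n. h k = pair_fock \<sigma> \<tau> t u k"
    by (rule pairs_of_outcome[OF s A R dr h hnz])
  have "A + R = click_fock \<sigma> u + out_fock \<sigma> \<tau> t"
    unfolding sum_pair_fock[symmetric] h[symmetric] by (simp add: hk)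
  from meas_out_unique[OF this A click_fock_in_meas R out_fock_modes] show ?thesis
    using that by blast
qed

end

subsection \<open>The output state\<close>

lemma size_eq_sum_mc:
  "finite S \<Longrightarrow> \<forall>l\<in>#A. fst l \<in> S \<Longrightarrow> size A = (\<Sum>q\<in>S. mc A q)"
  by (induction A) (auto simp: sum.distrib of_bool_def)

text \<open>The modes are bounded and the pattern fixes the photon number. A sum over an infinite
  set of outcomes would be 0 by convention.\<close>

lemma finite_meas_set: "finite (meas_set n m)"
proof (rule finite_subset)
  let ?S = "(\<lambda>j. 2*n+j) ` {..<2*n}"
  have S: "?S = {2*n..<4*n}"
    using image_add_atLeastLessThan[of "2*n" 0 "2*n"] by (simp add: lessThan_atLeast0)
  show "meas_set n m \<subseteq> {A. set_mset A \<subseteq> {2*n..<4*n} \<times> UNIV \<and> size A = (\<Sum>j<2*n. m j)}"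
  proof
    fix A assume A: "A \<in> meas_set n m"
    then have "size A = (\<Sum>q\<in>?S. mc A q)"
      by (intro size_eq_sum_mc) (auto simp: S meas_set_def)
    also have "\<dots> = (\<Sum>j<2*n. m j)"
      using A by (subst sum.reindex) (auto simp: meas_set_def)
    finally show "A \<in> {A. set_mset A \<subseteq> {2*n..<4*n} \<times> UNIV \<and> size A = (\<Sum>j<2*n. m j)}"
      using A by (auto simp: meas_set_def)
  qed
qed (simp add: finite_multisets_of_size flip: multisets_of_size_def)

text \<open>\<open>D_lab\<close> changes no mode, so a preimage uses the modes of \<open>N\<close>
  and has its size; this makes the sums in \<open>conjD\<close> genuine finite sums.\<close>

lemma finite_D_lab_preimage: "finite {M. image_mset (D_lab k) M = N}"
proof (rule finite_subset)
  show "{M. image_mset (D_lab k) M = N} \<subseteq>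
      {M. set_mset M \<subseteq> fst ` set_mset N \<times> UNIV \<and> size M = size N}"
  proof clarify
    fix M :: fock
    have "fst (D_lab k l) = fst l" for l by (simp add: D_lab_def)
    then have "fst ` set_mset (image_mset (D_lab k) M) = fst ` set_mset M"
      by (simp add: image_image)
    then show "set_mset M \<subseteq> fst ` set_mset (image_mset (D_lab k) M) \<times> UNIV \<and>
        size M = size (image_mset (D_lab k) M)"
      by (auto simp: mem_Times_iff intro: rev_image_eqI)
  qed
qed (simp add: finite_multisets_of_size flip: multisets_of_size_def)

lemma vec_eq_lookup: "(\<And>l. count M l \<le> 1) \<Longrightarrow> vec P M = Poly_Mapping.lookup P M"
proof -
  assume *: "\<And>l. count M l \<le> 1"
  have "(\<Prod>l\<in>set_mset M. fact (count M l)) = (1 :: nat)"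
  proof (rule prod.neutral, rule ballI)
    show "fact (count M l) = (1 :: nat)" for l
      using *[of l] by (cases "count M l") auto
  qed
  then show ?thesis by (simp add: vec_def)
qed

lemma dtrace_phase_mode: "dtrace (phase_mode q \<rho>) = dtrace \<rho>"
  by (simp add: dtrace_def phase_mode_def flip: mult_2)

lemma dtrace_cmult: "dtrace (\<lambda>R R'. c * \<rho> R R') = c * dtrace \<rho>"
  by (simp add: dtrace_def infsum_cmult_right')

lemma dnormalize_eqI:
  assumes "\<And>R R'. \<gamma> R R' = c * \<delta> R R'" "c \<noteq> 0" "dtrace \<delta> = 1"
  shows "dnormalize \<gamma> = \<delta>"
proof -
  have "\<gamma> = (\<lambda>R R'. c * \<delta> R R')" using assms(1) by (intro ext)
  then show ?thesis using assms(2,3) by (intro ext) (simp add: dnormalize_def dtrace_cmult)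
qed

section \<open>State of the output modes after the measurement\<close>

context analyzer_run
begin

text \<open>The photons of such an outcome sit in distinct modes, so \<open>vec\<close> carries no
  factorials and equals the bare coefficient.\<close>

lemma count_outcome: "count (click_fock \<sigma> u + out_fock \<sigma>' \<tau> t) l \<le> 1"
proof -
  have "inj_on (\<lambda>k. (click n m (grp n k \<sigma>), k = i \<and> u)) {..<n}"
    using click_inj grp_inj grp_less by (intro inj_onI) blast
  then have c: "click_fock \<sigma> u = mset_set ((\<lambda>k. (click n m (grp n k \<sigma>), k = i \<and> u)) ` {..<n})"
    by (simp add: click_fock_def image_mset_mset_set)
  have "inj_on (\<lambda>k. (rail k (if k = i then \<tau> else \<sigma>'), k = i \<and> t)) {..<n}"
    by (auto simp: inj_on_def)
  then have o: "out_fock \<sigma>' \<tau> t = mset_set ((\<lambda>k. (rail k (if k = i then \<tau> else \<sigma>'), k = i \<and> t)) ` {..<n})"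
    by (simp add: out_fock_def image_mset_mset_set)
  show ?thesis
    unfolding c o by (auto simp: count_mset_set')
qed

definition amplitude :: "(nat \<Rightarrow> bool) \<Rightarrow> bool \<Rightarrow> bool \<Rightarrow> bool \<Rightarrow> bool \<Rightarrow> complex" where
  "amplitude s \<sigma> \<tau> t u = (\<Prod>k<n. Poly_Mapping.lookup (pair_poly s k) (pair_fock \<sigma> \<tau> t u k))"

lemma vec_outcome:
  assumes s: "\<forall>j. s j \<longrightarrow> j = 2*i \<or> j = 2*i+1" and A: "A \<in> meas_set n m"
  shows "vec (protocol_optics n (input_poly n s)) (A + out_fock \<sigma> \<tau> t) =
    (\<Sum>u\<in>UNIV. if A = click_fock \<sigma> u then amplitude s \<sigma> \<tau> t u else 0)"
proof (cases "\<exists>u. A = click_fock \<sigma> u")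
  case True
  then obtain u where u: "A = click_fock \<sigma> u" by blast
  then have "A = click_fock \<sigma> u' \<longleftrightarrow> u' = u" for u' using click_fock_label by blast
  then have "(\<Sum>u\<in>UNIV. if A = click_fock \<sigma> u then amplitude s \<sigma> \<tau> t u else 0) = amplitude s \<sigma> \<tau> t u"
    by simp
  then show ?thesis
    using vec_eq_lookup[OF count_outcome] lookup_protocol_outcome[OF s] by (simp add: u amplitude_def)
next
  case False
  have "Poly_Mapping.lookup (protocol_optics n (input_poly n s)) (A + out_fock \<sigma> \<tau> t) = 0"
  proof (rule ccontr)
    assume nz: "Poly_Mapping.lookup (protocol_optics n (input_poly n s)) (A + out_fock \<sigma> \<tau> t) \<noteq> 0"
    have dr: "dual_rail n (out_fock \<sigma> \<tau> t) \<or> s (2*i) = s (2*i+1)"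
      by (simp add: dual_rail_out_fock)
    have "\<exists>\<sigma>' \<tau>' t' u'. A = click_fock \<sigma>' u' \<and> out_fock \<sigma> \<tau> t = out_fock \<sigma>' \<tau>' t'"
      by (rule outcome_support[OF s A out_fock_modes dr nz]) (intro exI conjI)
    then show False using False out_fock_inj(1) by blast
  qed
  then show ?thesis using False by (simp add: vec_def)
qed

lemma grp_image: "(\<lambda>k. grp n k \<sigma>) ` {..<n} = {..<n}"
  by (auto simp: grp_less) (metis grp_surj imageI lessThan_iff)

text \<open>With all detected photons in \<open>\<psi>\<^sub>0\<close> the record is one photon per
  clicked mode whatever the side, which keeps the sides coherent. A photon in
  \<open>\<psi>\<^sub>1\<close> sits in analyzer pair \<open>grp n i \<sigma>\<close> and reveals
  \<open>\<sigma>\<close>.\<close>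

lemma click_fock_eq_iff: "click_fock \<sigma> u = click_fock \<sigma>' u' \<longleftrightarrow> u = u' \<and> (\<sigma> = \<sigma>' \<or> \<not> u)"
proof -
  have "inj_on (\<lambda>k. grp n k \<sigma>) {..<n}" for \<sigma>
    using grp_inj by (blast intro: inj_onI)
  then have "image_mset (\<lambda>k. grp n k \<sigma>) (mset_set {..<n}) = mset_set {..<n}" for \<sigma>
    by (simp add: image_mset_mset_set grp_image)
  then have "image_mset (\<lambda>g. (click n m g, False)) (image_mset (\<lambda>k. grp n k \<sigma>) (mset_set {..<n})) =
      image_mset (\<lambda>g. (click n m g, False)) (mset_set {..<n})" for \<sigma>
    by simp
  then have F: "click_fock \<sigma> False = image_mset (\<lambda>g. (click n m g, False)) (mset_set {..<n})" for \<sigma>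
    by (simp add: click_fock_def image_mset.compositionality o_def)
  have "(click n m (grp n i \<sigma>'), True) \<in># click_fock \<sigma> True \<longleftrightarrow> \<sigma> = \<sigma>'" for \<sigma> \<sigma>'
  proof -
    have "(click n m (grp n i \<sigma>'), True) \<in># click_fock \<sigma> True \<longleftrightarrow> grp n i \<sigma> = grp n i \<sigma>'"
      using i_less click_inj[of "grp n i \<sigma>'" "grp n i \<sigma>"] grp_less[OF i_less]
      by (auto simp: click_fock_def image_iff intro: bexI[of _ i])
    then show ?thesis using grp_neq[OF i_less] by (cases \<sigma>; cases \<sigma>') auto
  qed
  then have "click_fock \<sigma> True = click_fock \<sigma>' True \<Longrightarrow> \<sigma> = \<sigma>'" by metis
  then show ?thesis
    using F[of \<sigma>] F[of \<sigma>'] click_fock_label[of \<sigma> u \<sigma>' u'] by (cases u; cases u') auto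
qed

text \<open>Matrix elements of the unnormalised state left by outcome \<open>m\<close> for the pure
  input with labels \<open>s\<close>; mixed inputs give weighted sums of these.\<close>

definition meas_kernel :: "(nat \<Rightarrow> bool) \<Rightarrow> dens" where
  "meas_kernel s R R' = (\<Sum>A\<in>meas_set n m. vec (protocol_optics n (input_poly n s)) (A + R) *
     cnj (vec (protocol_optics n (input_poly n s)) (A + R')))"

lemma meas_kernel_out_fock:
  assumes s: "\<forall>j. s j \<longrightarrow> j = 2*i \<or> j = 2*i+1"
  shows "meas_kernel s (out_fock \<sigma> \<tau> t) (out_fock \<sigma>' \<tau>' t') =
    (\<Sum>u\<in>UNIV. if \<sigma> = \<sigma>' \<or> \<not> u then amplitude s \<sigma> \<tau> t u * cnj (amplitude s \<sigma>' \<tau>' t' u) else 0)"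
proof -
  have "meas_kernel s (out_fock \<sigma> \<tau> t) (out_fock \<sigma>' \<tau>' t') =
    (\<Sum>A\<in>meas_set n m. \<Sum>u\<in>UNIV. \<Sum>u'\<in>UNIV. if A = click_fock \<sigma> u then
       if click_fock \<sigma> u = click_fock \<sigma>' u' then amplitude s \<sigma> \<tau> t u * cnj (amplitude s \<sigma>' \<tau>' t' u') else 0 else 0)"
    unfolding meas_kernel_def
    by (intro sum.cong refl) (auto simp: vec_outcome[OF s] cnj_sum sum_product intro!: sum.cong)
  also have "\<dots> = (\<Sum>u\<in>UNIV. \<Sum>u'\<in>UNIV. \<Sum>A\<in>meas_set n m. if A = click_fock \<sigma> u then
       if click_fock \<sigma> u = click_fock \<sigma>' u' then amplitude s \<sigma> \<tau> t u * cnj (amplitude s \<sigma>' \<tau>' t' u') else 0 else 0)"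
    by (subst sum.swap, intro sum.cong refl, rule sum.swap)
  also have "\<dots> = (\<Sum>u\<in>UNIV. \<Sum>u'\<in>UNIV.
       if click_fock \<sigma> u = click_fock \<sigma>' u' then amplitude s \<sigma> \<tau> t u * cnj (amplitude s \<sigma>' \<tau>' t' u') else 0)"
    by (intro sum.cong refl) (simp add: finite_meas_set click_fock_in_meas)
  finally show ?thesis by (simp add: click_fock_eq_iff UNIV_bool)
qed

definition out_focks :: "fock set" where
  "out_focks = {R. \<exists>\<sigma> \<tau> t. R = out_fock \<sigma> \<tau> t}"

lemma meas_kernel_zero:
  assumes s: "\<forall>j. s j \<longrightarrow> j = 2*i \<or> j = 2*i+1"
    and R: "\<forall>l\<in>#R. fst l < 2 * n" and dr: "dual_rail n R \<or> s (2*i) = s (2*i+1)"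
    and "R \<notin> out_focks"
  shows "meas_kernel s R R' = 0" "meas_kernel s R' R = 0"
proof -
  have "vec (protocol_optics n (input_poly n s)) (A + R) = 0" if "A \<in> meas_set n m" for A
    using outcome_support[OF s that R dr] \<open>R \<notin> out_focks\<close>
    unfolding vec_def out_focks_def by (metis (mono_tags, lifting) mem_Collect_eq mult_eq_0_iff)
  then show "meas_kernel s R R' = 0" "meas_kernel s R' R = 0"
    by (simp_all add: meas_kernel_def)
qed

text \<open>On the even side there is one factor -1 for each analyzer pair whose odd mode stays
  dark; their number \<open>n - s_odd n m\<close> has the parity of
  \<open>n + s_odd n m\<close>.\<close>

lemma prod_click_amp:
  "(\<Prod>k<n. click_amp n m k \<sigma>) = (if \<sigma> then 1 else (-1) ^ (n + s_odd n m)) / complex_of_real (sqrt 2) ^ n"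
proof -
  have "bij_betw (\<lambda>k. grp n k False) {..<n} {..<n}"
    unfolding bij_betw_def grp_image using grp_inj by (blast intro: inj_onI)
  then have "(\<Prod>k<n. click_sg m (grp n k False)) = (\<Prod>g<n. click_sg m g)"
    by (rule prod.reindex_bij_betw)
  also have "\<dots> = (\<Prod>g<n. (-1) ^ (1 + m (2*g+1)))"
  proof (rule prod.cong)
    fix g assume "g \<in> {..<n}"
    then have "m (2*g+1) = 0 \<or> m (2*g+1) = 1" using success_pair[of g] by auto
    then show "click_sg m g = (-1) ^ (1 + m (2*g+1))" by (auto simp: click_sg_def sg_def)
  qed simp
  also have "\<dots> = (-1) ^ (\<Sum>g<n. 1 + m (2*g+1))" by (simp add: power_sum)
  also have "(\<Sum>g<n. 1 + m (2*g+1)) = n + s_odd n m" by (simp only: sum.distrib) (simp add: s_odd_def)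
  finally show ?thesis by (simp add: click_amp_def prod_dividef)
qed

text \<open>The sign is that of side \<open>False\<close>. The powers collect
  \<open>1 / sqrt 2\<close> per click, \<open>1 / 4\<close> from factor \<open>i\<close> and
  \<open>1 / 2\<close> from each of the other \<open>n - 1\<close> factors.\<close>

definition norm_const :: complex where
  "norm_const = (-1) ^ (n + s_odd n m) / (complex_of_real (sqrt 2) ^ n * 2 ^ (n + 1))"

lemma norm_const_nonzero: "norm_const \<noteq> 0"
  by (simp add: norm_const_def)

lemma amplitude_eq:
  assumes s: "\<forall>j. s j \<longrightarrow> j = 2*i \<or> j = 2*i+1"
  shows "amplitude s \<sigma> \<tau> t u = norm_const * (if \<sigma> \<and> even (s_odd n m) then -1 else 1) *
    (of_bool (t = s (2*i) \<and> u = s (2*i+1)) * sg \<sigma> + of_bool (u = s (2*i) \<and> t = s (2*i+1)) * sg \<tau>)"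
proof -
  let ?q = "of_bool (t = s (2*i) \<and> u = s (2*i+1)) * sg \<sigma> + of_bool (u = s (2*i) \<and> t = s (2*i+1)) * sg \<tau>"
  have r: "s (rail i False) = s (2*i)" "s (rail i True) = s (2*i+1)" by (simp_all add: rail_def)
  have "Poly_Mapping.lookup (pair_poly s k) (pair_fock \<sigma> \<tau> t u k) =
      click_amp n m k \<sigma> * (if k = i then ?q / 4 else sg \<sigma> / 2)" if "k < n" for k
  proof -
    have sF: "\<not> s (rail k b)" if "k \<noteq> i" for b
      using s[rule_format, of "rail k b"] rail_eq_iff[of k b i False] rail_eq_iff[of k b i True] that
      by (auto simp: rail_def)
    show ?thesis
    proof (cases "k = i")
      case True
      have "pair_fock \<sigma> \<tau> t u i = {#(port i \<tau> False, t), (port i \<sigma> True, u)#}"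
        by (simp add: pair_fock_def port_def)
      then have "Poly_Mapping.lookup (pair_poly s i) (pair_fock \<sigma> \<tau> t u i) = ?q * 1 * click_amp n m i \<sigma> / 4"
        using lookup_pair_poly[OF i_less, of \<tau> \<sigma> False True s t u] unfolding r by simp
      then show ?thesis unfolding True
        by (simp only: simp_thms if_True mult_1_left mult_1_right times_divide_eq_right mult.commute)
    next
      case False
      have "pair_fock \<sigma> \<tau> t u k = {#(port k \<sigma> False, False), (port k \<sigma> True, False)#}"
        using False by (simp add: pair_fock_def port_def)
      then have "Poly_Mapping.lookup (pair_poly s k) (pair_fock \<sigma> \<tau> t u k) = (sg \<sigma> + sg \<sigma>) * click_amp n m k \<sigma> / 4"
        using lookup_pair_poly[OF that, of \<sigma> \<sigma> False True s False False] sF[OF False] by simp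
      then show ?thesis using False by simp
    qed
  qed
  then have "amplitude s \<sigma> \<tau> t u = (\<Prod>k<n. click_amp n m k \<sigma>) * (\<Prod>k<n. if k = i then ?q / 4 else sg \<sigma> / 2)"
    unfolding amplitude_def prod.distrib[symmetric] by (intro prod.cong) auto
  also have "(\<Prod>k<n. if k = i then ?q / 4 else sg \<sigma> / 2) = ?q / 4 * (sg \<sigma> / 2) ^ (n - 1)"
    using i_less by (subst prod.remove[of _ i]) (auto simp: prod_constant cong: prod.cong_simp)
  finally have a: "amplitude s \<sigma> \<tau> t u = (\<Prod>k<n. click_amp n m k \<sigma>) * (?q / 4 * (sg \<sigma> / 2) ^ (n - 1))" .
  obtain N where N: "n = Suc N" using i_less by (cases n) auto
  \<comment> \<open>On the odd side the \<open>n - 1\<close> ideal factors give this sign; it is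
    compared with the sign in \<open>norm_const\<close>.\<close>
  have "(-1 :: complex) ^ (n - 1) = - ((-1) ^ (n + s_odd n m)) * (-1) ^ s_odd n m"
    unfolding N by (simp add: power_add flip: power_mult_distrib)
  then have "(\<Prod>k<n. click_amp n m k \<sigma>) * (sg \<sigma> / 2) ^ (n - 1) =
      norm_const * 4 * (if \<sigma> \<and> even (s_odd n m) then -1 else 1)"
    unfolding prod_click_amp norm_const_def power_divide 
    by (cases \<sigma>; cases "even (s_odd n m)") (simp_all add: sg_def N field_simps)
  then show ?thesis unfolding a by (simp add: mult_ac)
qed

text \<open>Multiplied by \<open>sg \<sigma>\<close> it is 1 for even \<open>s_odd n m\<close> and
  \<open>sg \<sigma>\<close> for odd, the phase that the final correction undoes.\<close>

definition side_phase :: "bool \<Rightarrow> complex" where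
  "side_phase \<sigma> = (if \<sigma> \<and> even (s_odd n m) then -1 else 1)"

text \<open>Opposite labels force \<open>u = (\<not> t)\<close>, so coherence between the sides
  needs \<open>t\<close>. The sign belongs to the photon that entered the odd mode: it is the
  detected one if \<open>t = b\<close>, the outgoing one otherwise.\<close>

lemma meas_kernel_opposite:
  assumes s: "\<forall>j. s j \<longrightarrow> j = 2*i \<or> j = 2*i+1"
    and b: "s (2*i) = b" "s (2*i+1) = (\<not> b)"
  shows "meas_kernel s (out_fock \<sigma> \<tau> t) (out_fock \<sigma>' \<tau>' t') =
    norm_const * cnj norm_const * (side_phase \<sigma> * side_phase \<sigma>') *
      (of_bool (t = t' \<and> (\<sigma> = \<sigma>' \<or> t)) * (if t = b then sg \<sigma> * sg \<sigma>' else sg \<tau> * sg \<tau>'))"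
proof -
  have cnj: "cnj (side_phase x) = side_phase x" "cnj (sg x) = sg x" for x
    by (simp_all add: side_phase_def sg_def)
  show ?thesis
    unfolding meas_kernel_out_fock[OF s] amplitude_eq[OF s] b side_phase_def[symmetric]
    by (cases b; cases t; cases t') (simp_all add: UNIV_bool cnj)
qed

text \<open>Both \<open>t\<close> and \<open>u\<close> must be \<open>True\<close>, so the detected
  photon reveals the side, and \<open>sg \<sigma> + sg \<tau>\<close> vanishes unless
  \<open>\<tau> = \<sigma>\<close>.\<close>

lemma meas_kernel_equal:
  assumes s: "\<forall>j. s j \<longrightarrow> j = 2*i \<or> j = 2*i+1"
    and b: "s (2*i) = True" "s (2*i+1) = True"
  shows "meas_kernel s (out_fock \<sigma> \<tau> t) (out_fock \<sigma>' \<tau>' t') =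
    norm_const * cnj norm_const * (4 * of_bool (t \<and> t' \<and> \<sigma> = \<sigma>' \<and> \<tau> = \<sigma> \<and> \<tau>' = \<sigma>'))"
proof -
  have cnj: "cnj (side_phase x) = side_phase x" "cnj (sg x) = sg x"
    and sq: "side_phase x * side_phase x = 1" for x
    by (simp_all add: side_phase_def sg_def)
  have "meas_kernel s (out_fock \<sigma> \<tau> t) (out_fock \<sigma>' \<tau>' t') =
      norm_const * cnj norm_const * (side_phase \<sigma> * side_phase \<sigma>') *
      (of_bool (t \<and> t' \<and> \<sigma> = \<sigma>') * (sg \<sigma> + sg \<tau>) * (sg \<sigma>' + sg \<tau>'))"
    unfolding meas_kernel_out_fock[OF s] amplitude_eq[OF s] b side_phase_def[symmetric]
    by (cases t; cases t') (simp_all add: UNIV_bool cnj)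
  also have "\<dots> = norm_const * cnj norm_const * (4 * of_bool (t \<and> t' \<and> \<sigma> = \<sigma>' \<and> \<tau> = \<sigma> \<and> \<tau>' = \<sigma>'))"
    by (cases "\<sigma> = \<sigma>'"; cases \<sigma>; cases \<tau>; cases \<tau>') (simp_all add: sq sg_def)
  finally show ?thesis .
qed

section \<open>Target states on the basis states \<open>out_fock\<close>\<close>

lemma Bplus_vec_eq: "Bplus_vec n R =
    (if R = out_fock False False False then 1 / complex_of_real (sqrt 2) else 0) +
    (if R = out_fock True True False then 1 / complex_of_real (sqrt 2) else 0)"
proof -
  have "mset (map (\<lambda>k. (2*k, False)) [0..<n]) = out_fock False False False"
    "mset (map (\<lambda>k. (2*k+1, False)) [0..<n]) = out_fock True True False"
    by (simp_all add: out_fock_def rail_def atLeast0LessThan)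
  then show ?thesis using out_fock_inj(1)[of False False False True True False]
    by (auto simp: Bplus_vec_def)
qed

lemma out_fock_eq_iff: "out_fock \<sigma> \<tau> t = out_fock \<sigma>' \<tau>' t' \<longleftrightarrow> \<sigma> = \<sigma>' \<and> \<tau> = \<tau>' \<and> t = t'"
  using out_fock_inj by blast

lemma Bplus_vec_out: "Bplus_vec n (out_fock \<sigma> \<tau> t) = of_bool (\<tau> = \<sigma> \<and> \<not> t) / complex_of_real (sqrt 2)"
  by (auto simp: Bplus_vec_eq out_fock_eq_iff)

lemma Bplus_vec_zero: "R \<notin> out_focks \<Longrightarrow> Bplus_vec n R = 0"
  by (auto simp: Bplus_vec_eq out_focks_def)

lemma sqrt2_mult: "complex_of_real (sqrt 2) * complex_of_real (sqrt 2) = 2"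
  by (simp flip: of_real_mult)

lemma Bplus_out: "Bplus n (out_fock \<sigma> \<tau> t) (out_fock \<sigma>' \<tau>' t') =
    of_bool (\<tau> = \<sigma> \<and> \<not> t \<and> \<tau>' = \<sigma>' \<and> \<not> t') / 2"
  by (auto simp: Bplus_def Bplus_vec_out sqrt2_mult)

lemma D_lab_out_fock: "image_mset (D_lab i) (out_fock \<sigma> \<tau> t) = out_fock \<sigma> \<tau> True"
proof -
  have "D_lab i (rail k (if k = i then \<tau> else \<sigma>), k = i \<and> t) = (rail k (if k = i then \<tau> else \<sigma>), k = i \<and> True)" for k
    using rail_eq_iff[of k \<sigma> i False] rail_eq_iff[of k \<sigma> i True]
    by (auto simp: D_lab_def rail_def)
  then show ?thesis by (simp add: out_fock_def image_mset.compositionality o_def)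
qed

lemma conjD_Bplus: "conjD i (Bplus n) N N' =
    (\<Sum>M\<in>{M. image_mset (D_lab i) M = N}. Bplus_vec n M) *
    cnj (\<Sum>M\<in>{M. image_mset (D_lab i) M = N'}. Bplus_vec n M)"
  by (simp add: conjD_def Bplus_def sum_product cnj_sum)

lemma D_lab_Bplus_vec: "(\<Sum>M\<in>{M. image_mset (D_lab i) M = N}. Bplus_vec n M) =
    (if N = out_fock False False True then 1 / complex_of_real (sqrt 2) else 0) +
    (if N = out_fock True True True then 1 / complex_of_real (sqrt 2) else 0)"
  unfolding Bplus_vec_eq sum.distrib
  by (simp add: finite_D_lab_preimage D_lab_out_fock eq_commute[of N])

lemma conjD_Bplus_out: "conjD i (Bplus n) (out_fock \<sigma> \<tau> t) (out_fock \<sigma>' \<tau>' t') =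
    of_bool (\<tau> = \<sigma> \<and> t \<and> \<tau>' = \<sigma>' \<and> t') / 2"
  by (auto simp: conjD_Bplus D_lab_Bplus_vec out_fock_eq_iff sqrt2_mult)

lemma swap_out_fock: "image_mset (swap_lab i) (out_fock \<sigma> \<tau> t) = out_fock \<sigma> (\<not> \<tau>) t"
proof -
  have "swap_lab i (rail k (if k = i then \<tau> else \<sigma>), k = i \<and> t) = (rail k (if k = i then \<not> \<tau> else \<sigma>), k = i \<and> t)" for k
    using rail_eq_iff[of k \<sigma> i False] rail_eq_iff[of k \<sigma> i True]
    by (auto simp: swap_lab_def rail_def)
  then show ?thesis by (simp add: out_fock_def image_mset.compositionality o_def)
qed

lemma swap_notin_out_focks: "R \<notin> out_focks \<Longrightarrow> image_mset (swap_lab i) R \<notin> out_focks"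
proof -
  have "swap_lab i (swap_lab i l) = l" for l
    by (cases l) (auto simp: swap_lab_def)
  then have "image_mset (swap_lab i) (image_mset (swap_lab i) R) = R"
    by (simp add: image_mset.compositionality o_def)
  then show "R \<notin> out_focks \<Longrightarrow> image_mset (swap_lab i) R \<notin> out_focks"
    using swap_out_fock unfolding out_focks_def by fastforce
qed

lemma mc_out_fock_odd: "mc (out_fock \<sigma> \<tau> t) (2*i+1) = of_bool \<tau>"
  using mc_out_fock[OF i_less, of \<sigma> \<tau> t True] by (simp add: rail_def)

lemma mc_out_fock_1: "mc (out_fock \<sigma> \<tau> t) 1 = of_bool (if i = 0 then \<tau> else \<sigma>)"
  using mc_out_fock[of 0 \<sigma> \<tau> t True] i_less by (simp add: rail_def)

section \<open>Operators supported on the states \<open>out_fock\<close>\<close>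

definition supported :: "dens \<Rightarrow> bool" where
  "supported \<rho> \<longleftrightarrow> (\<forall>R R'. R \<notin> out_focks \<or> R' \<notin> out_focks \<longrightarrow> \<rho> R R' = 0)"

lemma supported_Bplus: "supported (Bplus n)"
  by (auto simp: supported_def Bplus_def Bplus_vec_zero)

lemma supported_conjD_Bplus: "supported (conjD i (Bplus n))"
  by (auto simp: supported_def conjD_Bplus D_lab_Bplus_vec out_focks_def)

lemma supported_conjX: "supported \<rho> \<Longrightarrow> supported (conjX i \<rho>)"
  using swap_notin_out_focks by (auto simp: supported_def conjX_def)

lemma supported_phase_mode: "supported \<rho> \<Longrightarrow> supported (phase_mode q \<rho>)"
  by (auto simp: supported_def phase_mode_def)

lemma supported_twirl: "supported \<rho> \<Longrightarrow> supported (f \<rho>) \<Longrightarrow> supported (twirl f \<rho>)"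
  by (auto simp: supported_def twirl_def)

lemma supported_dmix: "supported \<rho> \<Longrightarrow> supported \<rho>' \<Longrightarrow> supported (dmix \<rho> \<rho>')"
  by (auto simp: supported_def dmix_def)

lemma supported_eqI:
  assumes "supported \<gamma>" "supported \<delta>"
    and "\<And>\<sigma> \<tau> t \<sigma>' \<tau>' t'. \<gamma> (out_fock \<sigma> \<tau> t) (out_fock \<sigma>' \<tau>' t') =
      c * \<delta> (out_fock \<sigma> \<tau> t) (out_fock \<sigma>' \<tau>' t')"
  shows "\<gamma> R R' = c * \<delta> R R'"
  using assms unfolding supported_def out_focks_def by (cases "R \<in> out_focks \<and> R' \<in> out_focks")
    (auto simp: out_focks_def)

lemma dtrace_supported:
  assumes "supported \<rho>"
  shows "dtrace \<rho> = (\<Sum>\<sigma>\<in>UNIV. \<Sum>\<tau>\<in>UNIV. \<Sum>t\<in>UNIV. \<rho> (out_fock \<sigma> \<tau> t) (out_fock \<sigma> \<tau> t))"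
proof -
  let ?f = "\<lambda>(\<sigma>, \<tau>, t). out_fock \<sigma> \<tau> t"
  have eq: "out_focks = range ?f" by (auto simp: out_focks_def image_def)
  have inj: "inj ?f" by (auto simp: inj_def out_fock_eq_iff)
  have "dtrace \<rho> = infsum (\<lambda>R. \<rho> R R) out_focks"
    unfolding dtrace_def using assms by (intro infsum_cong_neutral) (auto simp: supported_def)
  also have "\<dots> = (\<Sum>R\<in>range ?f. \<rho> R R)"
    unfolding eq by (rule infsum_finite) simp
  also have "\<dots> = (\<Sum>x\<in>UNIV. \<rho> (?f x) (?f x))"
    by (subst sum.reindex[OF inj]) simp
  also have "\<dots> = (\<Sum>\<sigma>\<in>UNIV. \<Sum>\<tau>\<in>UNIV. \<Sum>t\<in>UNIV. \<rho> (out_fock \<sigma> \<tau> t) (out_fock \<sigma> \<tau> t))"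
    unfolding UNIV_Times_UNIV[symmetric] by (simp add: sum.cartesian_product split_def)
  finally show ?thesis .
qed

section \<open>Phase correction and comparison with the targets\<close>

definition correct :: "dens \<Rightarrow> dens" where
  "correct \<rho> = (if odd (s_odd n m) then phase_mode 1 \<rho> else \<rho>)"

lemma ghz_out_correct: "ghz_out n m E = dnormalize (correct (unnorm_out n m E))"
  unfolding ghz_out_def correct_def ..

lemma dtrace_correct: "dtrace (correct \<rho>) = dtrace \<rho>"
  by (simp add: correct_def dtrace_phase_mode)

lemma correct_zero: "\<rho> R R' = 0 \<Longrightarrow> correct \<rho> R R' = 0"
  by (simp add: correct_def phase_mode_def)

text \<open>Mode 1 is the odd rail of qubit 0, so the correction reads \<open>\<tau>\<close> if
  \<open>i = 0\<close> and \<open>\<sigma>\<close> otherwise.\<close>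

lemma correct_out: "correct \<rho> (out_fock \<sigma> \<tau> t) (out_fock \<sigma>' \<tau>' t') =
    (if odd (s_odd n m) \<and> (if i = 0 then \<tau> \<noteq> \<tau>' else \<sigma> \<noteq> \<sigma>') then -1 else 1) *
      \<rho> (out_fock \<sigma> \<tau> t) (out_fock \<sigma>' \<tau>' t')"
  by (auto simp: correct_def phase_mode_def mc_out_fock_1[simplified])

lemma unnorm_out_single: "unnorm_out n m [(p, input_poly n s)] R R' =
    (if (\<forall>l\<in>#R. fst l < 2*n) \<and> (\<forall>l\<in>#R'. fst l < 2*n) then complex_of_real p * meas_kernel s R R' else 0)"
  by (simp add: unnorm_out_def post_meas_def ens_dens_def meas_kernel_def sum_distrib_left mult.assoc)

lemma unnorm_out_pair: "unnorm_out n m [(p, input_poly n s), (p', input_poly n s')] R R' =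
    (if (\<forall>l\<in>#R. fst l < 2*n) \<and> (\<forall>l\<in>#R'. fst l < 2*n)
     then complex_of_real p * meas_kernel s R R' + complex_of_real p' * meas_kernel s' R R' else 0)"
  by (simp add: unnorm_out_def post_meas_def ens_dens_def meas_kernel_def sum_distrib_left mult.assoc sum.distrib)

text \<open>The entries with \<open>t = False\<close>, where the detected photon is in
  \<open>\<psi>\<^sub>1\<close>, form the Z-dephased part; those with \<open>t = True\<close> form
  the coherent part with \<open>conjD\<close>. The free side \<open>\<tau>\<close> accounts for the
  X twirl.\<close>

lemma orthogonal_pair_output:
  assumes "dtrace (unnorm_out n m [(1/2, input_poly n (\<lambda>j. j = 2*i+1)), (1/2, input_poly n (\<lambda>j. j = 2*i))]) \<noteq> 0"
  shows "dr_proj n (ghz_out n m [(1/2, input_poly n (\<lambda>j. j = 2*i+1)), (1/2, input_poly n (\<lambda>j. j = 2*i))])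
    = twirl (conjX i) (dmix (twirl (conjZ i) (Bplus n)) (conjD i (Bplus n)))"
proof -
  let ?s = "\<lambda>j. j = 2*i+1" and ?s' = "\<lambda>j. j = 2*i"
  let ?U = "unnorm_out n m [(1/2, input_poly n ?s), (1/2, input_poly n ?s')]"
  let ?T = "twirl (conjX i) (dmix (twirl (conjZ i) (Bplus n)) (conjD i (Bplus n)))"
  let ?G = "\<lambda>R R'. if dual_rail n R \<and> dual_rail n R' then dnormalize (correct ?U) R R' else 0"
  \<comment> \<open>The 8 cancels the 1/8 of the target entries; \<open>dtrace ?U\<close> stems from
    the normalisation inside \<open>ghz_out\<close> and cancels when \<open>dr_proj\<close>
    renormalises.\<close>
  let ?c = "8 * norm_const * cnj norm_const / dtrace ?U"
  have s: "\<forall>j. ?s j \<longrightarrow> j = 2*i \<or> j = 2*i+1" "\<forall>j. ?s' j \<longrightarrow> j = 2*i \<or> j = 2*i+1"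
    by auto
  have sT: "supported ?T"
    unfolding conjZ_def
    by (intro supported_twirl supported_conjX supported_dmix supported_phase_mode
        supported_Bplus supported_conjD_Bplus)
  have T_out: "?T (out_fock \<sigma> \<tau> t) (out_fock \<sigma>' \<tau>' t') =
     (of_bool (t = t' \<and> (\<tau> = \<sigma>) = (\<tau>' = \<sigma>') \<and> (\<sigma> = \<sigma>' \<or> t))) / 8"
    for \<sigma> \<tau> t \<sigma>' \<tau>' t'
    by (cases \<sigma>; cases \<tau>; cases t; cases \<sigma>'; cases \<tau>'; cases t')
      (simp_all add: twirl_def conjX_def conjZ_def phase_mode_def dmix_def swap_out_fock Bplus_out
        conjD_Bplus_out mc_out_fock_odd[simplified])
  have sG: "supported ?G"
    unfolding supported_def
    using meas_kernel_zero[OF s(1)] meas_kernel_zero[OF s(2)]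
    by (auto simp: dnormalize_def unnorm_out_pair intro!: correct_zero)
  have G_out: "?G (out_fock \<sigma> \<tau> t) (out_fock \<sigma>' \<tau>' t') = ?c * ?T (out_fock \<sigma> \<tau> t) (out_fock \<sigma>' \<tau>' t')"
    for \<sigma> \<tau> t \<sigma>' \<tau>' t'
  proof -
    let ?ph = "if odd (s_odd n m) \<and> (if i = 0 then \<tau> \<noteq> \<tau>' else \<sigma> \<noteq> \<sigma>') then - 1 else 1 :: complex"
    let ?B = "of_bool (t = t' \<and> (\<sigma> = \<sigma>' \<or> t)) :: complex"
    let ?x = "if t = False then sg \<sigma> * sg \<sigma>' else sg \<tau> * sg \<tau>'"
    let ?y = "if t = True then sg \<sigma> * sg \<sigma>' else sg \<tau> * sg \<tau>'"
    have K1: "meas_kernel ?s (out_fock \<sigma> \<tau> t) (out_fock \<sigma>' \<tau>' t') =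
        norm_const * cnj norm_const * (side_phase \<sigma> * side_phase \<sigma>') * (?B * ?x)"
      by (rule meas_kernel_opposite[OF s(1)]) auto
    have K2: "meas_kernel ?s' (out_fock \<sigma> \<tau> t) (out_fock \<sigma>' \<tau>' t') =
        norm_const * cnj norm_const * (side_phase \<sigma> * side_phase \<sigma>') * (?B * ?y)"
      by (rule meas_kernel_opposite[OF s(2)]) auto
    have sum: "?x + ?y = sg \<sigma> * sg \<sigma>' + sg \<tau> * sg \<tau>'"
      by (cases t) simp_all
    have arith: "p * (complex_of_real (1/2) * (N * P * (B * x)) + complex_of_real (1/2) * (N * P * (B * y))) / d =
        N / d * (p * P * B * (x + y) / 2)" for p N P B x y d
      by (simp add: algebra_simps add_divide_distrib)
    have "?G (out_fock \<sigma> \<tau> t) (out_fock \<sigma>' \<tau>' t') = ?ph *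
      (complex_of_real (1/2) * meas_kernel ?s (out_fock \<sigma> \<tau> t) (out_fock \<sigma>' \<tau>' t') +
       complex_of_real (1/2) * meas_kernel ?s' (out_fock \<sigma> \<tau> t) (out_fock \<sigma>' \<tau>' t')) / dtrace ?U"
      by (simp only: out_fock_modes[THEN eqTrueI] dual_rail_out_fock dnormalize_def dtrace_correct correct_out unnorm_out_pair simp_thms if_True)
    also have "\<dots> = norm_const * cnj norm_const / dtrace ?U * (?ph * (side_phase \<sigma> * side_phase \<sigma>') *
        of_bool (t = t' \<and> (\<sigma> = \<sigma>' \<or> t)) * (sg \<sigma> * sg \<sigma>' + sg \<tau> * sg \<tau>') / 2)"
      unfolding K1 K2 sum[symmetric] by (rule arith)
    \<comment> \<open>The sum of signs vanishes unless \<open>\<sigma>\<close> and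
      \<open>\<tau>\<close> both flip or both stay; then reading \<open>\<tau>\<close> or
      \<open>\<sigma>\<close> gives the same correction, and all phases cancel.\<close>
    also have "?ph * (side_phase \<sigma> * side_phase \<sigma>') *
        of_bool (t = t' \<and> (\<sigma> = \<sigma>' \<or> t)) * (sg \<sigma> * sg \<sigma>' + sg \<tau> * sg \<tau>') / 2 =
        of_bool (t = t' \<and> (\<tau> = \<sigma>) = (\<tau>' = \<sigma>') \<and> (\<sigma> = \<sigma>' \<or> t))"
      by (cases \<sigma>; cases \<tau>; cases \<sigma>'; cases \<tau>') (simp_all add: side_phase_def sg_def)
    finally show ?thesis unfolding T_out by simp
  qed
  have "dnormalize ?G = ?T"
  proof (rule dnormalize_eqI)
    show "?G R R' = ?c * ?T R R'" for R R'
      by (rule supported_eqI[OF sG sT G_out])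
    show "?c \<noteq> 0" using assms norm_const_nonzero by simp
    show "dtrace ?T = 1"
      unfolding dtrace_supported[OF sT] T_out by (simp add: UNIV_bool)
  qed
  then show ?thesis
    unfolding dr_proj_def ghz_out_correct .
qed

lemma equal_pair_output:
  assumes "dtrace (unnorm_out n m [(1, input_poly n (\<lambda>j. j = 2*i \<or> j = 2*i+1))]) \<noteq> 0"
  shows "ghz_out n m [(1, input_poly n (\<lambda>j. j = 2*i \<or> j = 2*i+1))] = twirl (conjZ i) (conjD i (Bplus n))"
proof -
  let ?s = "\<lambda>j. j = 2*i \<or> j = 2*i+1"
  let ?U = "unnorm_out n m [(1, input_poly n ?s)]"
  let ?T = "twirl (conjZ i) (conjD i (Bplus n))"
  let ?c = "8 * norm_const * cnj norm_const"
  have s: "\<forall>j. ?s j \<longrightarrow> j = 2*i \<or> j = 2*i+1"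
    by auto
  have sT: "supported ?T"
    unfolding conjZ_def
    by (intro supported_twirl supported_phase_mode supported_conjD_Bplus)
  have T_out: "?T (out_fock \<sigma> \<tau> t) (out_fock \<sigma>' \<tau>' t') =
     (of_bool (t \<and> t' \<and> \<tau> = \<sigma> \<and> \<tau>' = \<sigma>' \<and> \<sigma> = \<sigma>')) / 2"
    for \<sigma> \<tau> t \<sigma>' \<tau>' t'
    by (cases \<sigma>; cases \<tau>; cases t; cases \<sigma>'; cases \<tau>'; cases t')
      (simp_all add: twirl_def conjZ_def phase_mode_def conjD_Bplus_out mc_out_fock_odd[simplified])
  \<comment> \<open>Equal labels alone confine the state to the \<open>out_fock\<close> states, so
    no dual-rail projection is called for.\<close>
  have sG: "supported (correct ?U)"
    unfolding supported_def
    using meas_kernel_zero[OF s]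
    by (auto simp: unnorm_out_single intro!: correct_zero)
  have G_out: "correct ?U (out_fock \<sigma> \<tau> t) (out_fock \<sigma>' \<tau>' t') = ?c * ?T (out_fock \<sigma> \<tau> t) (out_fock \<sigma>' \<tau>' t')"
    for \<sigma> \<tau> t \<sigma>' \<tau>' t'
  proof -
    have K: "meas_kernel ?s (out_fock \<sigma> \<tau> t) (out_fock \<sigma>' \<tau>' t') = norm_const * cnj norm_const *
        (4 * of_bool (t \<and> t' \<and> \<sigma> = \<sigma>' \<and> \<tau> = \<sigma> \<and> \<tau>' = \<sigma>'))"
      by (rule meas_kernel_equal[OF s]) auto
    have "correct ?U (out_fock \<sigma> \<tau> t) (out_fock \<sigma>' \<tau>' t') =
      (if odd (s_odd n m) \<and> (if i = 0 then \<tau> \<noteq> \<tau>' else \<sigma> \<noteq> \<sigma>') then - 1 else 1) *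
      (complex_of_real 1 * meas_kernel ?s (out_fock \<sigma> \<tau> t) (out_fock \<sigma>' \<tau>' t'))"
      by (simp only: out_fock_modes[THEN eqTrueI] correct_out unnorm_out_single simp_thms if_True)
    \<comment> \<open>Nonzero entries have \<open>\<sigma> = \<sigma>'\<close> and
      \<open>\<tau> = \<tau>'\<close>, where the correction phase is 1.\<close>
    also have "\<dots> = ?c * ?T (out_fock \<sigma> \<tau> t) (out_fock \<sigma>' \<tau>' t')"
      unfolding T_out K by auto
    finally show ?thesis .
  qed
  have "dnormalize (correct ?U) = ?T"
  proof (rule dnormalize_eqI)
    show "correct ?U R R' = ?c * ?T R R'" for R R'
      by (rule supported_eqI[OF sG sT G_out])
    show "?c \<noteq> 0" using norm_const_nonzero by simp
    show "dtrace ?T = 1"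
      unfolding dtrace_supported[OF sT] T_out by (simp add: UNIV_bool)
  qed
  then show ?thesis unfolding ghz_out_correct .
qed

end

theorem theorem2:
  fixes n i :: nat and m :: "nat \<Rightarrow> nat"
  assumes "n \<ge> 3" and "i < n"
  shows
    "(heralds n m [(1/2, input_poly n (\<lambda>j. j = 2*i+1)), (1/2, input_poly n (\<lambda>j. j = 2*i))]
       \<longrightarrow> dr_proj n (ghz_out n m [(1/2, input_poly n (\<lambda>j. j = 2*i+1)), (1/2, input_poly n (\<lambda>j. j = 2*i))])
           = twirl (conjX i) (dmix (twirl (conjZ i) (Bplus n)) (conjD i (Bplus n))))
     \<and> (heralds n m [(1, input_poly n (\<lambda>j. j = 2*i \<or> j = 2*i+1))]
       \<longrightarrow> ghz_out n m [(1, input_poly n (\<lambda>j. j = 2*i \<or> j = 2*i+1))]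
           = twirl (conjZ i) (conjD i (Bplus n)))"
proof -
  have "analyzer_run n i m" if "analyzer_success n m"
    using assms that by unfold_locales auto
  then show ?thesis
    using analyzer_run.orthogonal_pair_output analyzer_run.equal_pair_output
    unfolding heralds_def by blast
qed

end
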